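(* Consider the sequence of $GI/GI/1+GI$ queues described in the context, and assume that conditions (A1)–(A5) stated there hold. Then for every sufficiently large $n$ there exists a unique stationary probability distribution for the Markov process $\mathbb X^n=\{(\tau^n(t),V^n(t)):t\ge 0\}$ on $\mathbb S=\mathbb R_+\times\mathbb R_+$.
   Context: Model. $\mathbb N=\{1,2,\dots\}$, $\mathbb N_0=\mathbb N\cup\{0\}$, $\mathbb R_+=[0,\infty)$. For each $n\in\mathbb N$ consider a single-server first-in-first-out queue with customer abandonment. On a common probability space there are i.i.d. sequences of nonnegative random variables with unit mean, $\{u_i\}_{i\ge 2}$ and $\{v_i\}_{i\ge 1}$, and for each $n$ an i.i.d. sequence of nonnegative patience times $\{d_i^n\}_{i\ge1}$ with right-continuous distribution function $F^n$; for each $n$ the three sequences $\{u_i\},\{v_i\},\{d^n_i\}$ are mutually independent. Let $\lambda^n,\mu^n>0$. In the $n$-th system the interarrival times are $u_j^n=u_j/\lambda^n$ ($j\ge2$) and the service times are $v_j^n=v_j/\mu^n$ ($j\ge1$). Given an initial state $(\tau_0,v_0)\in\mathbb S=\mathbb R_+\times\mathbb R_+$ (remaining time to the first arrival, and initial offered waiting time), the arrival times are $t_1^n=\tau_0$ and $t_i^n=\tau_0+\sum_{j=2}^i u_j^n$ for $i\ge2$; $t_0^n\le 0$ denotes the time of the last arrival at or before time $0$. Let $A^n(t)=\max\{i\in\mathbb N_0: t_i^n\le t\}$. The $i$-th customer abandons without service if its processing does not begin by time $t_i^n+d_i^n$. The offered waiting time process $V^n$ is the nonnegative process satisfying $$V^n(t)=v_0+\sum_{j=1}^{A^n(t)}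 v_j^n\,\mathbf 1_{[V^n(t_j^n-)<d_j^n]}-\int_0^t \mathbf 1_{[V^n(s)>0]}\,ds\ \ge 0,\qquad t\ge0$$ (if $t_1^n=0$, $V^n(t_1^n-)$ is read as $v_0$). The remaining arrival time is $\tau^n(t)=t_{j+1}^n-t$ for $t\in[t_j^n,t_{j+1}^n)$, $j\in\mathbb N_0$. The process $\mathbb X^n=\{(\tau^n(t),V^n(t)):t\ge0\}$ is a strong Markov process with state space $\mathbb S$. Assumptions. (A1) For some $p\in(2,\infty)$, $\mathbb E[u_2^p+v_2^p]<\infty$. (A2) $\lambda^n=n\lambda$ with $\lambda\in(0,\infty)$, $\lim_{n\to\infty}\mu^n/n=\lambda$, and $\lim_{n\to\infty}\sqrt n\,(\lambda-\mu^n/n)=\theta\in\mathbb R$. (A3) $F^n(0)=0$ for all $n$, and there is a nonnegative continuously differentiable function $H$ on $\mathbb R_+$ such that for each $K>0$, $\lim_{n\to\infty}\sup_{x\in[0,K]}\left|\sqrt n F^n(x/\sqrt n)-H(x)\right|=0$. (A4) $\lim_{x\to\infty}H(x)>\theta/\lambda$. (A5) The interarrival times are unbounded: $\mathbb P(u_2\ge u)>0$ for every $u>0$. *)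

theory Defs
  imports "HOL-Probability.Probability"
begin

section \<open>Sample paths of a single-server queue with abandonment\<close>

text \<open>
  Pathwise data: \<open>\<tau>0\<close> is the time of the first arrival, \<open>v0\<close> the initial offered waiting time,
  \<open>a j\<close> (for \<open>j \<ge> 2\<close>) the interarrival times, \<open>s j\<close> and \<open>d j\<close> (for \<open>j \<ge> 1\<close>) the service and
  patience times.  Customers are numbered from 1; the value \<open>arrival_time \<tau>0 a 0\<close> is never used.
\<close>

definition arrival_time :: "real \<Rightarrow> (nat \<Rightarrow> real) \<Rightarrow> nat \<Rightarrow> real" where
  "arrival_time \<tau>0 a i = \<tau>0 + (\<Sum>j=2..i. a j)"

text \<open>
  The index 0 stands for the last arrival at or before time 0, so it always belongs to the set.
  The set is finite for every \<open>t\<close> on almost every path, since interarrival times have positive mean.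
\<close>

definition num_arrivals :: "real \<Rightarrow> (nat \<Rightarrow> real) \<Rightarrow> real \<Rightarrow> nat" where
  "num_arrivals \<tau>0 a t = Max {i. i = 0 \<or> arrival_time \<tau>0 a i \<le> t}"

definition remaining_arrival_time :: "real \<Rightarrow> (nat \<Rightarrow> real) \<Rightarrow> real \<Rightarrow> real" where
  "remaining_arrival_time \<tau>0 a t = arrival_time \<tau>0 a (num_arrivals \<tau>0 a t + 1) - t"

text \<open>The left limit \<open>V(t-)\<close>, with the convention \<open>V(0-) = v0\<close>.\<close>

definition left_value :: "real \<Rightarrow> (real \<Rightarrow> real) \<Rightarrow> real \<Rightarrow> real" where
  "left_value v0 V t = (if t \<le> 0 then v0 else Lim (at_left t) V)"

definition offered_waiting_path ::
  "real \<Rightarrow> real \<Rightarrow> (nat \<Rightarrow> real) \<Rightarrow> (nat \<Rightarrow> real) \<Rightarrow> (nat \<Rightarrow> real) \<Rightarrow> (real \<Rightarrow> real) \<Rightarrow> bool" where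
  "offered_waiting_path \<tau>0 v0 a s d V \<longleftrightarrow>
     (\<forall>t\<ge>0. V t \<ge> 0 \<and>
        indicat_real {r. V r > 0} integrable_on {0..t} \<and>
        V t = v0
              + (\<Sum>j=1..num_arrivals \<tau>0 a t.
                   s j * of_bool (left_value v0 V (arrival_time \<tau>0 a j) < d j))
              - integral {0..t} (indicat_real {r. V r > 0}))"

section \<open>The sequence of queues\<close>

datatype primitive = Interarrival | Service | Patience

fun primitive_index :: "primitive \<Rightarrow> nat set" where
  "primitive_index Interarrival = {2..}"
| "primitive_index Service = {1..}"
| "primitive_index Patience = {1..}"

fun primitive_seq ::
  "(nat \<Rightarrow> 'w \<Rightarrow> real) \<Rightarrow> (nat \<Rightarrow> 'w \<Rightarrow> real) \<Rightarrow> (nat \<Rightarrow> 'w \<Rightarrow> real) \<Rightarrow>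
   primitive \<Rightarrow> nat \<Rightarrow> 'w \<Rightarrow> real" where
  "primitive_seq u v d Interarrival = u"
| "primitive_seq u v d Service = v"
| "primitive_seq u v d Patience = d"

text \<open>
  \<open>u\<close> and \<open>v\<close> are the unscaled interarrival and service sequences shared by all systems,
  \<open>d n\<close> the patience times of the \<open>n\<close>-th system with distribution function \<open>F n\<close>,
  \<open>\<Lambda> n\<close> and \<open>\<mu> n\<close> its arrival and service rates.  Systems are indexed by \<open>n \<ge> 1\<close>.
  The last assumption is the mutual independence of the three sequences, viewed as
  random elements of sequence space.
\<close>

locale abandonment_queues = prob_space M
  for M :: "'w measure" +
  fixes u v :: "nat \<Rightarrow> 'w \<Rightarrow> real"
    and d :: "nat \<Rightarrow> nat \<Rightarrow> 'w \<Rightarrow> real"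
    and F :: "nat \<Rightarrow> real \<Rightarrow> real"
    and \<Lambda> \<mu> :: "nat \<Rightarrow> real"
  assumes u_nonneg: "\<And>i \<omega>. i \<ge> 2 \<Longrightarrow> \<omega> \<in> space M \<Longrightarrow> u i \<omega> \<ge> 0"
    and v_nonneg: "\<And>i \<omega>. i \<ge> 1 \<Longrightarrow> \<omega> \<in> space M \<Longrightarrow> v i \<omega> \<ge> 0"
    and d_nonneg: "\<And>n i \<omega>. n \<ge> 1 \<Longrightarrow> i \<ge> 1 \<Longrightarrow> \<omega> \<in> space M \<Longrightarrow> d n i \<omega> \<ge> 0"
    and u_indep: "indep_vars (\<lambda>_. borel) u {2..}"
    and v_indep: "indep_vars (\<lambda>_. borel) v {1..}"
    and d_indep: "\<And>n. n \<ge> 1 \<Longrightarrow> indep_vars (\<lambda>_. borel) (d n) {1..}"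
    and u_identical: "\<And>i. i \<ge> 2 \<Longrightarrow> distr M borel (u i) = distr M borel (u 2)"
    and v_identical: "\<And>i. i \<ge> 1 \<Longrightarrow> distr M borel (v i) = distr M borel (v 1)"
    and d_cdf: "\<And>n i. n \<ge> 1 \<Longrightarrow> i \<ge> 1 \<Longrightarrow> cdf (distr M borel (d n i)) = F n"
    and u_mean: "\<And>i. i \<ge> 2 \<Longrightarrow> expectation (u i) = 1"
    and v_mean: "\<And>i. i \<ge> 1 \<Longrightarrow> expectation (v i) = 1"
    and rates_pos: "\<And>n. n \<ge> 1 \<Longrightarrow> \<Lambda> n > 0" "\<And>n. n \<ge> 1 \<Longrightarrow> \<mu> n > 0"
    and sequences_indep: "\<And>n. n \<ge> 1 \<Longrightarrow>
      indep_vars (\<lambda>k. PiM (primitive_index k) (\<lambda>_. borel))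
        (\<lambda>k \<omega>. \<lambda>i\<in>primitive_index k. primitive_seq u v (d n) k i \<omega>) UNIV"

definition state_space :: "(real \<times> real) set" where
  "state_space = {0..} \<times> {0..}"

text \<open>
  \<open>Y t \<omega>\<close> is the offered waiting time process of the system with arrival rate \<open>lam\<close>, service
  rate \<open>mu\<close>, patience times \<open>d\<close> and initial state \<open>x = (\<tau>0, v0)\<close>.
\<close>

definition offered_waiting_process ::
  "'w measure \<Rightarrow> (nat \<Rightarrow> 'w \<Rightarrow> real) \<Rightarrow> (nat \<Rightarrow> 'w \<Rightarrow> real) \<Rightarrow> (nat \<Rightarrow> 'w \<Rightarrow> real) \<Rightarrow>
   real \<Rightarrow> real \<Rightarrow> real \<times> real \<Rightarrow> (real \<Rightarrow> 'w \<Rightarrow> real) \<Rightarrow> bool" where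
  "offered_waiting_process M u v d lam mu x Y \<longleftrightarrow>
     (\<forall>t\<ge>0. Y t \<in> borel_measurable M) \<and>
     (AE \<omega> in M. offered_waiting_path (fst x) (snd x)
        (\<lambda>j. u j \<omega> / lam) (\<lambda>j. v j \<omega> / mu) (\<lambda>j. d j \<omega>) (\<lambda>t. Y t \<omega>))"

definition queue_state ::
  "(nat \<Rightarrow> 'w \<Rightarrow> real) \<Rightarrow> real \<Rightarrow> (real \<times> real \<Rightarrow> real \<Rightarrow> 'w \<Rightarrow> real) \<Rightarrow>
   real \<times> real \<Rightarrow> real \<Rightarrow> 'w \<Rightarrow> real \<times> real" where
  "queue_state u lam V x t \<omega> =
     (remaining_arrival_time (fst x) (\<lambda>j. u j \<omega> / lam) t, V x t \<omega>)"

text \<open>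
  \<open>X x t \<omega>\<close> is the state at time \<open>t\<close> of the process started from \<open>x \<in> S\<close>, so that
  \<open>P\<^sub>t(x, A) = emeasure M {\<omega> \<in> space M. X x t \<omega> \<in> A}\<close> is the transition function.  A probability
  measure \<open>\<pi>\<close> on the Borel sets of \<open>S\<close> is stationary if \<open>\<pi> P\<^sub>t = \<pi>\<close> for all \<open>t \<ge> 0\<close>, i.e. the
  process started with law \<open>\<pi>\<close> independently of \<open>M\<close> has law \<open>\<pi>\<close> at all times.
\<close>

definition stationary_distribution ::
  "'w measure \<Rightarrow> 's::topological_space set \<Rightarrow> ('s \<Rightarrow> real \<Rightarrow> 'w \<Rightarrow> 's) \<Rightarrow> 's measure \<Rightarrow> bool" where
  "stationary_distribution M S X \<pi> \<longleftrightarrow>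
     prob_space \<pi> \<and> sets \<pi> = sets (restrict_space borel S) \<and>
     (\<forall>t\<ge>0. \<forall>A\<in>sets \<pi>.
        emeasure \<pi> A = (\<integral>\<^sup>+x. emeasure M {\<omega> \<in> space M. X x t \<omega> \<in> A} \<partial>\<pi>))"

end

theory Submission
  imports Defs
begin

text \<open>
  Fix one system and look at it when customers arrive.  The state seen by a customer is a Markov chain
  driven by independent inputs (service time, patience, time to the next arrival), and the state
  \<open>(0, 0)\<close> of a customer who finds an empty queue is a regeneration point.  For all large \<open>n\<close> there
  is a level \<open>b\<close> such that the customers with patience beyond \<open>b\<close> arrive more slowly than they can
  be served (\<open>eventually_stable\<close>), so the workload has negative drift above \<open>b\<close>; and since
  interarrival times are unbounded, the queue empties within one step with a probability bounded below
  on bounded sets of workloads.  A Lyapunov function combines both facts and shows that the mean time to reach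
  \<open>(0, 0)\<close> is finite from everywhere (\<open>exists_lyapunov\<close>, \<open>taboo_sum_finite\<close>).
  
  Existence.  The expected visits during an excursion from \<open>(0, 0)\<close> form a finite invariant measure of
  the chain (\<open>cycle_law_invariant\<close>).  Averaging the continuous-time state over the gap that follows
  an arrival, with the chain distributed according to this measure, gives a stationary law
  (\<open>palm_measure_stationary\<close>).  The proof only moves the window of integration along the time axis and
  uses the renewal equation for the occupation probabilities.
  
  Uniqueness.  Interarrival times may be lattice valued, so the transition probabilities need not
  converge, but their time averages do.  Queues started from different states see, after a finite random
  time, a customer in state \<open>(0, 0)\<close>, and from then on they have the same law up to a shift of time.  Hence the time
  averages from all initial states have the same asymptotics (\<open>occupation_time_compare\<close>), and a
  stationary law, being the mean of its own time averages, is determined (\<open>invariant_law_le\<close>).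
  
  The link with the given processes is pathwise: the offered waiting time equation determines its
  solution (\<open>offered_waiting_path_eq\<close>), so the law of the state at time \<open>t\<close> is the transition
  function computed from the chain (\<open>queue_transition\<close>).
\<close>

section \<open>The workload path between arrivals\<close>

text \<open>
  Both the workload seen by successive customers and its Markov description arise from iterating
  a map \<open>G\<close> along a sequence of inputs; keeping the iteration separate from the inputs lets the
  same recursion be read pathwise and in distribution.
\<close>

primrec driven_seq :: "('z \<Rightarrow> 'e \<Rightarrow> 'z) \<Rightarrow> 'z \<Rightarrow> (nat \<Rightarrow> 'e) \<Rightarrow> nat \<Rightarrow> 'z" where
  "driven_seq G z e 0 = z"
| "driven_seq G z e (Suc k) = G (driven_seq G z e k) (e k)"

text \<open>
  The queue is watched at the arrivals.  An input \<open>(a, s, p)\<close> consists of a customer's service time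
  \<open>s\<close>, patience \<open>p\<close> and the time \<open>a\<close> until the next arrival.  A state \<open>(l, w)\<close> just before
  a customer joins keeps two numbers because interarrival times may vanish: the patience is compared
  with the left limit \<open>l\<close> of the offered waiting time at the arrival epoch, whereas the work \<open>w\<close>
  already contains the services of customers who arrived earlier at the same epoch.
\<close>

definition work_after :: "real \<times> real \<Rightarrow> real \<times> real \<times> real \<Rightarrow> real" where
  "work_after = (\<lambda>(l, w) (a, s, p). w + s * of_bool (l < p))"

definition next_arrival_state :: "real \<times> real \<Rightarrow> real \<times> real \<times> real \<Rightarrow> real \<times> real" where
  "next_arrival_state C e =
     (let w = max 0 (work_after C e - fst e) in (if 0 < fst e then w else fst C, w))"

lemma arrival_time_Suc: "k \<ge> 1 \<Longrightarrow> arrival_time \<tau>0 a (Suc k) = arrival_time \<tau>0 a k + a (Suc k)"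
  by (simp add: arrival_time_def)

lemma arrival_time_mono:
  assumes "\<And>j. j \<ge> 2 \<Longrightarrow> a j \<ge> 0" "i \<le> j"
  shows "arrival_time \<tau>0 a i \<le> arrival_time \<tau>0 a j"
  unfolding arrival_time_def using assms by (auto intro!: sum_mono2)

lemma num_arrivals_eqI:
  assumes "\<And>j. j \<ge> 2 \<Longrightarrow> a j \<ge> 0" and "k \<ge> 1 \<Longrightarrow> arrival_time \<tau>0 a k \<le> t"
    and "t < arrival_time \<tau>0 a (Suc k)"
  shows "num_arrivals \<tau>0 a t = k"
proof -
  have "{i. i = 0 \<or> arrival_time \<tau>0 a i \<le> t} = {..k}"
  proof (intro set_eqI iffI)
    fix i assume i: "i \<in> {i. i = 0 \<or> arrival_time \<tau>0 a i \<le> t}"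
    show "i \<in> {..k}"
    proof (rule ccontr)
      assume "i \<notin> {..k}"
      then have "Suc k \<le> i" "i \<noteq> 0" by auto
      then show False using arrival_time_mono[of a "Suc k" i \<tau>0] assms i by auto
    qed
  next
    fix i assume "i \<in> {..k}"
    then show "i \<in> {i. i = 0 \<or> arrival_time \<tau>0 a i \<le> t}"
      using arrival_time_mono[of a i k \<tau>0] assms by (cases "i = 0") fastforce+
  qed
  then show ?thesis unfolding num_arrivals_def by (auto intro!: Max_eqI)
qed

lemma busy_indicator_integral_bounds:
  fixes V :: "real \<Rightarrow> real"
  assumes int: "\<And>t. 0 \<le> t \<Longrightarrow> indicat_real {r. V r > 0} integrable_on {0..t}"
    and xy: "0 \<le> x" "x \<le> y"
  defines "I \<equiv> \<lambda>t. integral {0..t} (indicat_real {r. V r > 0})"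
  shows "I x \<le> I y" and "I y - I x \<le> y - x"
    and "(\<And>r. x \<le> r \<Longrightarrow> r \<le> y \<Longrightarrow> V r > 0) \<Longrightarrow> I y - I x = y - x"
proof -
  have eq: "I y - I x = integral {x..y} (indicat_real {r. V r > 0})"
    using Henstock_Kurzweil_Integration.integral_combine[OF xy int[of y]] xy unfolding I_def by simp
  have int2: "indicat_real {r. V r > 0} integrable_on {x..y}"
    by (rule integrable_subinterval_real[OF int[of y]]) (use xy in auto)
  have "0 \<le> integral {x..y} (indicat_real {r. V r > 0})"
    by (rule integral_nonneg[OF int2]) simp
  then show "I x \<le> I y" using eq by simp
  have "integral {x..y} (indicat_real {r. V r > 0}) \<le> integral {x..y} (\<lambda>_. 1)"
    by (rule integral_le[OF int2]) (auto simp: indicator_def)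
  then show "I y - I x \<le> y - x" using eq xy by simp
  assume pos: "\<And>r. x \<le> r \<Longrightarrow> r \<le> y \<Longrightarrow> V r > 0"
  have "integral {x..y} (indicat_real {r. V r > 0}) = integral {x..y} (\<lambda>_. 1)"
    by (rule integral_cong) (use pos in auto)
  then show "I y - I x = y - x" using eq xy by simp
qed

text \<open>
  Between arrivals the workload equation reads \<open>V t = b - (I t - I x)\<close>, where \<open>I\<close> is the
  busy time.  It forces depletion at unit rate: \<open>V\<close> is nonincreasing, so \<open>V t > 0\<close> means that
  the server was busy throughout, and \<open>V t = 0\<close> means that the work was at most the elapsed time.
  At the right end \<open>y\<close> the values pass to the limit since \<open>I\<close> is continuous.
\<close>
lemma depletion_at_unit_rate:
  fixes V I :: "real \<Rightarrow> real"
  assumes xy: "0 \<le> x" "x < y"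
    and int: "\<And>t. 0 \<le> t \<Longrightarrow> indicat_real {r. V r > 0} integrable_on {0..t}"
    and I: "\<And>t. I t = integral {0..t} (indicat_real {r. V r > 0})"
    and V: "\<And>t. x \<le> t \<Longrightarrow> t < y \<Longrightarrow> V t \<ge> 0 \<and> V t = b - I t + I x"
  shows "\<And>t. x \<le> t \<Longrightarrow> t < y \<Longrightarrow> V t = max 0 (b - (t - x))"
    and "b - I y + I x = max 0 (b - (y - x))"
    and "Lim (at_left y) V = max 0 (b - (y - x))"
proof -
  note bnd = busy_indicator_integral_bounds[of V, OF int, folded I]
  show *: "V t = max 0 (b - (t - x))" if t: "x \<le> t" "t < y" for t
  proof (cases "V t > 0")
    case True
    have "V r > 0" if "x \<le> r" "r \<le> t" for r
    proof -
      have "I r \<le> I t" using bnd(1)[of r t] that xy by auto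
      then show ?thesis using V[of r] V[of t] that t True by auto
    qed
    then have "I t - I x = t - x" using bnd(3)[of x t] t xy by auto
    then show ?thesis using V[of t] t True by auto
  next
    case False
    then show ?thesis using V[of t] t bnd(2)[of x t] xy by auto
  qed
  have tI: "((\<lambda>t. I t) \<longlongrightarrow> I y) (at_left y)"
  proof (rule tendsto_sandwich)
    have "\<forall>\<^sub>F t in at_left y. t \<in> {x<..<y}" using eventually_at_left_real xy by blast
    then have ev: "\<forall>\<^sub>F t in at_left y. I y - (y - t) \<le> I t \<and> I t \<le> I y"
    proof eventually_elim
      case (elim t)
      then show ?case using bnd(1,2)[of t y] xy by auto
    qed
    show "\<forall>\<^sub>F t in at_left y. I y - (y - t) \<le> I t" "\<forall>\<^sub>F t in at_left y. I t \<le> I y"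
      by (rule eventually_mono[OF ev]; simp)+
    show "((\<lambda>t. I y - (y - t)) \<longlongrightarrow> I y) (at_left y)" by (auto intro!: tendsto_eq_intros)
  qed simp
  have ev: "\<forall>\<^sub>F t in at_left y. x \<le> t \<and> t < y"
    using eventually_at_left_real[of x y] xy by (auto elim!: eventually_mono)
  have lim: "(V \<longlongrightarrow> max 0 (b - (y - x))) (at_left y)"
  proof (rule Lim_transform_eventually)
    show "((\<lambda>t. max 0 (b - (t - x))) \<longlongrightarrow> max 0 (b - (y - x))) (at_left y)"
      by (auto intro!: tendsto_intros)
    show "\<forall>\<^sub>F t in at_left y. max 0 (b - (t - x)) = V t"
      using ev by eventually_elim (use * in auto)
  qed
  show "Lim (at_left y) V = max 0 (b - (y - x))"
    by (rule tendsto_Lim[OF _ lim]) (simp add: trivial_limit_at_left_real)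
  have "(V \<longlongrightarrow> b - I y + I x) (at_left y)"
  proof (rule Lim_transform_eventually)
    show "((\<lambda>t. b - I t + I x) \<longlongrightarrow> b - I y + I x) (at_left y)" by (auto intro!: tendsto_intros tI)
    show "\<forall>\<^sub>F t in at_left y. b - I t + I x = V t"
      using ev by eventually_elim (use V in auto)
  qed
  then show "b - I y + I x = max 0 (b - (y - x))"
    using lim tendsto_unique[of "at_left y" V] by (simp add: trivial_limit_at_left_real)
qed

text \<open>
  The defining equation of the offered waiting time has at most one solution, and it is given by the
  recursion at arrivals.  The equation alone determines \<open>V\<close> on the interval between two arrivals
  from the work \<open>B k\<close> present after \<open>k\<close> customers, and by left limits the acceptance of the next
  customer.
\<close>

lemma offered_waiting_path_eq:
  fixes a s d :: "nat \<Rightarrow> real"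
  assumes path: "offered_waiting_path \<tau>0 v0 a s d V"
    and nonneg: "0 \<le> \<tau>0" "0 \<le> v0" "\<And>j. j \<ge> 2 \<Longrightarrow> a j \<ge> 0" "\<And>j. j \<ge> 1 \<Longrightarrow> s j \<ge> 0"
  defines "C \<equiv> driven_seq next_arrival_state (max 0 (v0 - \<tau>0), max 0 (v0 - \<tau>0))
                 (\<lambda>k. (a (k + 2), s (k + 1), d (k + 1)))"
  shows "0 \<le> t \<Longrightarrow> t < \<tau>0 \<Longrightarrow> V t = max 0 (v0 - t)"
    and "arrival_time \<tau>0 a (Suc k) \<le> t \<Longrightarrow> t < arrival_time \<tau>0 a (Suc (Suc k)) \<Longrightarrow>
           V t = max 0 (work_after (C k) (a (k + 2), s (k + 1), d (k + 1))
                        - (t - arrival_time \<tau>0 a (Suc k)))"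
proof -
  \<comment> \<open>Interval ends: time 0 takes the place of an arrival with number 0.\<close>
  define T where "T k = (if k = 0 then 0 else arrival_time \<tau>0 a k)" for k
  define I where "I t = integral {0..t} (indicat_real {r. V r > 0})" for t
  define L where "L j = left_value v0 V (arrival_time \<tau>0 a j)" for j
  define B where "B k = v0 + (\<Sum>j=1..k. s j * of_bool (L j < d j)) - I (T k)" for k
  have t1: "arrival_time \<tau>0 a (Suc 0) = \<tau>0" by (simp add: arrival_time_def)
  have Tmono: "T k \<le> T (Suc k)" for k
    using arrival_time_mono[of a k "Suc k" \<tau>0] nonneg t1 by (auto simp: T_def)
  have T0: "0 \<le> T k" for k
  proof (induction k)
    case 0 then show ?case by (simp add: T_def)
  next
    case (Suc k) then show ?case using Tmono[of k] by linarith
  qed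
  have int: "indicat_real {r. V r > 0} integrable_on {0..t}" if "0 \<le> t" for t
    using path that unfolding offered_waiting_path_def by blast
  have Veq: "V t \<ge> 0 \<and> V t = B k - I t + I (T k)" if t: "T k \<le> t" "t < T (Suc k)" for t k
  proof -
    have N: "num_arrivals \<tau>0 a t = k"
      by (rule num_arrivals_eqI) (use nonneg t in \<open>auto simp: T_def split: if_splits\<close>)
    have "0 \<le> t" using T0[of k] t by simp
    then show ?thesis
      using path[unfolded offered_waiting_path_def, rule_format, of t] N
      by (simp add: B_def I_def L_def)
  qed
  have seg: "V t = max 0 (B k - (t - T k))" if t: "T k \<le> t" "t < T (Suc k)" for t k
    by (rule depletion_at_unit_rate(1)[of "T k" "T (Suc k)" V I, OF T0 _ int I_def Veq]) (use t in auto)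
  have BSuc: "B (Suc k) = B k - I (T (Suc k)) + I (T k) + s (Suc k) * of_bool (L (Suc k) < d (Suc k))" for k
    by (simp add: B_def)
  have reach: "B k - I (T (Suc k)) + I (T k) = max 0 (B k - (T (Suc k) - T k))" if "0 \<le> B k" for k
  proof (cases "T k < T (Suc k)")
    case True
    then show ?thesis
      by (intro depletion_at_unit_rate(2)[of "T k" "T (Suc k)" V I, OF T0 _ int I_def Veq])
  next
    case False
    then show ?thesis using Tmono[of k] that by auto
  qed
  have Bnn: "0 \<le> B k" for k
  proof (induction k)
    case 0 then show ?case using nonneg by (simp add: B_def I_def T_def)
  next
    case (Suc k) then show ?case using reach[of k] BSuc[of k] nonneg(4)[of "Suc k"] by simp
  qed
  have Lval: "L (Suc k) = max 0 (B k - (T (Suc k) - T k))" if "T k < T (Suc k)" for k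
  proof -
    have "0 < arrival_time \<tau>0 a (Suc k)" using that T0[of k] by (auto simp: T_def)
    then have "L (Suc k) = Lim (at_left (T (Suc k))) V"
      by (simp add: L_def left_value_def T_def)
    also have "\<dots> = max 0 (B k - (T (Suc k) - T k))"
      by (rule depletion_at_unit_rate(3)[of "T k" "T (Suc k)" V I, OF T0 that int I_def Veq])
    finally show ?thesis .
  qed
  \<comment> \<open>If the gap before an arrival is empty, its left limit is that of the preceding customer.\<close>
  have CB: "C k = (L (Suc k), B k - I (T (Suc k)) + I (T k)) \<and>
      B (Suc k) = work_after (C k) (a (k + 2), s (k + 1), d (k + 1))" for k
  proof (induction k)
    case 0
    have B0: "B 0 = v0" by (simp add: B_def I_def T_def)
    have "L 1 = max 0 (v0 - \<tau>0)"
    proof (cases "\<tau>0 > 0")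
      case True then show ?thesis using Lval[of 0] B0 t1 by (simp add: T_def)
    next
      case False then show ?thesis using nonneg t1 by (simp add: L_def left_value_def)
    qed
    then have "C 0 = (L (Suc 0), B 0 - I (T (Suc 0)) + I (T 0))"
      using reach[of 0] B0 nonneg t1 by (simp add: C_def T_def)
    then show ?case using BSuc[of 0] by (simp add: work_after_def)
  next
    case (Suc k)
    have gap: "T (Suc (Suc k)) - T (Suc k) = a (k + 2)"
      using arrival_time_Suc[of "Suc k" \<tau>0 a] by (simp add: T_def)
    have "L (Suc (Suc k)) = (if 0 < a (k + 2) then max 0 (B (Suc k) - a (k + 2)) else L (Suc k))"
    proof (cases "0 < a (k + 2)")
      case True then show ?thesis using Lval[of "Suc k"] gap by simp
    next
      case False
      then have "T (Suc (Suc k)) = T (Suc k)" using gap nonneg(3)[of "k+2"] by simp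
      then show ?thesis using False by (simp add: L_def T_def)
    qed
    then have "C (Suc k) = (L (Suc (Suc k)), B (Suc k) - I (T (Suc (Suc k))) + I (T (Suc k)))"
      using Suc reach[of "Suc k"] Bnn[of "Suc k"] gap
      by (auto simp: C_def next_arrival_state_def Let_def)
    then show ?case using BSuc[of "Suc k"] by (simp add: work_after_def)
  qed
  show "V t = max 0 (v0 - t)" if "0 \<le> t" "t < \<tau>0"
    using seg[of 0 t] that t1 by (simp add: T_def B_def I_def)
  show "V t = max 0 (work_after (C k) (a (k + 2), s (k + 1), d (k + 1)) - (t - arrival_time \<tau>0 a (Suc k)))"
    if "arrival_time \<tau>0 a (Suc k) \<le> t" "t < arrival_time \<tau>0 a (Suc (Suc k))"
    using seg[of "Suc k" t] that CB[of k] by (simp add: T_def)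
qed

section \<open>Occupation probabilities and the transition function\<close>

lemma borel_measurable_fst_comp [measurable (raw)]:
  fixes f :: "'a \<Rightarrow> 'b::second_countable_topology \<times> 'c::second_countable_topology"
  assumes "f \<in> borel_measurable N"
  shows "(\<lambda>x. fst (f x)) \<in> borel_measurable N"
  using measurable_compose[OF assms, of fst borel] by (simp add: borel_prod[symmetric])

lemma borel_measurable_snd_comp [measurable (raw)]:
  fixes f :: "'a \<Rightarrow> 'b::second_countable_topology \<times> 'c::second_countable_topology"
  assumes "f \<in> borel_measurable N"
  shows "(\<lambda>x. snd (f x)) \<in> borel_measurable N"
  using measurable_compose[OF assms, of snd borel] by (simp add: borel_prod[symmetric])

lemma work_after_eq: "work_after C e = snd C + fst (snd e) * of_bool (fst C < snd (snd e))"
  by (simp add: work_after_def split_beta)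

lemma work_after_measurable [measurable (raw)]:
  assumes [measurable]: "f \<in> borel_measurable N" "g \<in> borel_measurable N"
  shows "(\<lambda>x. work_after (f x) (g x)) \<in> borel_measurable N"
  unfolding work_after_eq of_bool_def by measurable

lemma next_arrival_state_measurable [measurable (raw)]:
  assumes [measurable]: "f \<in> borel_measurable N" "g \<in> borel_measurable N"
  shows "(\<lambda>x. next_arrival_state (f x) (g x)) \<in> borel_measurable N"
  unfolding next_arrival_state_def Let_def by measurable

lemma snd_next_arrival_state_nonneg: "0 \<le> snd (next_arrival_state C e)"
  by (simp add: next_arrival_state_def Let_def)

text \<open>
  For independent inputs of law \<open>\<nu>\<close> this is the transition operator of the chain driven by \<open>G\<close>;
  its \<open>k\<close>-th power applied to \<open>\<phi>\<close> is the mean of \<open>\<phi>\<close> after \<open>k\<close> steps.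
\<close>

definition next_mean :: "'e measure \<Rightarrow> ('z \<Rightarrow> 'e \<Rightarrow> 'z) \<Rightarrow> ('z \<Rightarrow> ennreal) \<Rightarrow> 'z \<Rightarrow> ennreal" where
  "next_mean \<nu> G \<phi> z = (\<integral>\<^sup>+e. \<phi> (G z e) \<partial>\<nu>)"

text \<open>
  In \<open>(s, C)\<close> the first component is the time that is left until the observation time when the
  customer seeing state \<open>C\<close> arrives; it becomes negative once the observation time has passed.
\<close>

definition clock_step :: "real \<times> real \<times> real \<Rightarrow> real \<times> real \<times> real \<Rightarrow> real \<times> real \<times> real" where
  "clock_step z e = (fst z - fst e, next_arrival_state (snd z) e)"

text \<open>
  The observation falls into the interval that follows the current arrival exactly if
  \<open>0 \<le> s < a\<close>, and then \<open>(a - s, max 0 (work - s))\<close> is the observed state of the queue.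
\<close>

definition in_gap ::
  "(real \<times> real) set \<Rightarrow> real \<Rightarrow> real \<times> real \<Rightarrow> real \<times> real \<times> real \<Rightarrow> ennreal" where
  "in_gap A s C e =
     (if 0 \<le> s \<and> s < fst e then indicator A (fst e - s, max 0 (work_after C e - s)) else 0)"

lemma fst_clock_step: "fst (clock_step z e) = fst z - fst e"
  by (simp add: clock_step_def)

lemma clock_step_measurable [measurable (raw)]:
  assumes [measurable]: "f \<in> borel_measurable N" "g \<in> borel_measurable N"
  shows "(\<lambda>x. clock_step (f x) (g x)) \<in> borel_measurable N"
  unfolding clock_step_def by measurable

lemma in_gap_measurable [measurable (raw)]:
  assumes [measurable]: "A \<in> sets borel" "h \<in> borel_measurable N" "f \<in> borel_measurable N" "g \<in> borel_measurable N"
  shows "(\<lambda>x. in_gap A (h x) (f x) (g x)) \<in> borel_measurable N"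
  unfolding in_gap_def by measurable

lemma in_gap_le: "in_gap A s C e \<le> (if 0 \<le> s \<and> s < fst e then 1 else 0)"
  by (auto simp: in_gap_def indicator_def)

locale customer_law = prob_space \<nu> for \<nu> :: "(real \<times> real \<times> real) measure" +
  assumes sets_law [measurable_cong]: "sets \<nu> = sets borel"
    and law_nonneg: "AE e in \<nu>. 0 \<le> fst e \<and> 0 \<le> fst (snd e)"
begin

lemma next_mean_measurable [measurable]:
  assumes [measurable]: "\<phi> \<in> borel_measurable borel" "(\<lambda>x. G (fst x) (snd x)) \<in> borel \<Otimes>\<^sub>M \<nu> \<rightarrow>\<^sub>M borel"
  shows "next_mean \<nu> G \<phi> \<in> borel_measurable borel"
proof -
  have "(\<lambda>x. \<phi> (G (fst x) (snd x))) \<in> borel_measurable (borel \<Otimes>\<^sub>M \<nu>)" by measurable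
  then show ?thesis unfolding next_mean_def by measurable
qed

lemma next_mean_pow_measurable:
  assumes "\<phi> \<in> borel_measurable borel" "(\<lambda>x. G (fst x) (snd x)) \<in> borel \<Otimes>\<^sub>M \<nu> \<rightarrow>\<^sub>M borel"
  shows "(next_mean \<nu> G ^^ k) \<phi> \<in> borel_measurable borel"
  by (induction k) (use assms in \<open>auto intro: next_mean_measurable\<close>)

text \<open>
  \<open>occupation A s C\<close> is the probability that the queue is in \<open>A\<close> at time \<open>s\<close> after the arrival
  of a customer who sees \<open>C\<close>: a sum over the number \<open>k\<close> of arrivals in between.  \<open>flow\<close> is the
  same probability conditional on the first input \<open>e\<close>.
\<close>

definition gap_mean :: "(real \<times> real) set \<Rightarrow> real \<times> real \<times> real \<Rightarrow> ennreal" where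
  "gap_mean A z = (\<integral>\<^sup>+e. in_gap A (fst z) (snd z) e \<partial>\<nu>)"

definition occupation :: "(real \<times> real) set \<Rightarrow> real \<Rightarrow> real \<times> real \<Rightarrow> ennreal" where
  "occupation A s C = (\<Sum>k. (next_mean \<nu> clock_step ^^ k) (gap_mean A) (s, C))"

definition flow :: "(real \<times> real) set \<Rightarrow> real \<Rightarrow> real \<times> real \<Rightarrow> real \<times> real \<times> real \<Rightarrow> ennreal" where
  "flow A s C e = in_gap A s C e + occupation A (s - fst e) (next_arrival_state C e)"

lemma clock_step_measurable2 [measurable]: "(\<lambda>x. clock_step (fst x) (snd x)) \<in> borel \<Otimes>\<^sub>M \<nu> \<rightarrow>\<^sub>M borel"
  by measurable

lemma gap_mean_measurable [measurable]:
  assumes [measurable]: "A \<in> sets borel" shows "gap_mean A \<in> borel_measurable borel"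
  unfolding gap_mean_def by measurable

lemma occupation_summand_measurable [measurable]:
  assumes "A \<in> sets borel" shows "(next_mean \<nu> clock_step ^^ k) (gap_mean A) \<in> borel_measurable borel"
  by (intro next_mean_pow_measurable gap_mean_measurable clock_step_measurable2 assms)

lemma occupation_measurable [measurable (raw)]:
  assumes [measurable]: "A \<in> sets borel" "f \<in> borel_measurable N" "g \<in> borel_measurable N"
  shows "(\<lambda>x. occupation A (f x) (g x)) \<in> borel_measurable N"
proof -
  have "(\<lambda>x. (next_mean \<nu> clock_step ^^ k) (gap_mean A) (f x, g x)) \<in> borel_measurable N" for k
    by (rule measurable_compose[OF _ occupation_summand_measurable]) measurable
  then show ?thesis unfolding occupation_def by measurable
qed

lemma flow_measurable [measurable (raw)]:
  assumes [measurable]: "A \<in> sets borel" "h \<in> borel_measurable N" "f \<in> borel_measurable N" "g \<in> borel_measurable N"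
  shows "(\<lambda>x. flow A (h x) (f x) (g x)) \<in> borel_measurable N"
  unfolding flow_def by measurable

text \<open>
  The renewal equation, obtained by conditioning on the first input; existence and uniqueness of the
  stationary law both rest on it.
\<close>

lemma occupation_renewal:
  assumes [measurable]: "A \<in> sets borel"
  shows "occupation A s C = (\<integral>\<^sup>+e. flow A s C e \<partial>\<nu>)"
proof -
  let ?P = "\<lambda>k. (next_mean \<nu> clock_step ^^ k) (gap_mean A)"
  have "occupation A s C = (\<Sum>k. ?P (Suc k) (s, C)) + ?P 0 (s, C)"
    unfolding occupation_def by (subst suminf_offset[of _ 1]) (auto simp: add.commute)
  also have "(\<Sum>k. ?P (Suc k) (s, C)) = (\<Sum>k. \<integral>\<^sup>+e. ?P k (clock_step (s, C) e) \<partial>\<nu>)"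
    by (simp add: next_mean_def)
  also have "\<dots> = (\<integral>\<^sup>+e. (\<Sum>k. ?P k (clock_step (s, C) e)) \<partial>\<nu>)"
  proof (rule nn_integral_suminf[symmetric])
    fix k show "(\<lambda>e. ?P k (clock_step (s, C) e)) \<in> borel_measurable \<nu>"
      by (rule measurable_compose[OF _ occupation_summand_measurable]) measurable
  qed
  also have "\<dots> = (\<integral>\<^sup>+e. occupation A (s - fst e) (next_arrival_state C e) \<partial>\<nu>)"
    by (simp add: occupation_def clock_step_def)
  also have "?P 0 (s, C) = (\<integral>\<^sup>+e. in_gap A s C e \<partial>\<nu>)" by (simp add: gap_mean_def)
  also have "(\<integral>\<^sup>+e. occupation A (s - fst e) (next_arrival_state C e) \<partial>\<nu>) + (\<integral>\<^sup>+e. in_gap A s C e \<partial>\<nu>)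
     = (\<integral>\<^sup>+e. flow A s C e \<partial>\<nu>)"
    unfolding flow_def by (subst add.commute, rule nn_integral_add[symmetric]) measurable
  finally show ?thesis .
qed

text \<open>
  The intervals between successive arrivals are disjoint, so at most one term of the sum can count
  the observation time.  Inductively, a first gap that ends before \<open>s\<close> contributes nothing itself,
  and a first gap that contains \<open>s\<close> leaves a negative remaining time for all later ones.
\<close>

lemma occupation_le:
  assumes [measurable]: "A \<in> sets borel"
  shows "occupation A s C \<le> (if 0 \<le> s then 1 else 0)"
proof -
  let ?P = "\<lambda>k. (next_mean \<nu> clock_step ^^ k) (gap_mean A)"
  have "(\<Sum>k<n. ?P k z) \<le> (if 0 \<le> fst z then 1 else 0)" for n z
  proof (induction n arbitrary: z)
    case (Suc n)
    have [measurable]: "(\<lambda>e. ?P k (clock_step z e)) \<in> borel_measurable \<nu>" for k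
      by (rule measurable_compose[OF _ occupation_summand_measurable]) measurable
    have "(\<Sum>k<Suc n. ?P k z) = gap_mean A z + (\<Sum>k<n. \<integral>\<^sup>+e. ?P k (clock_step z e) \<partial>\<nu>)"
      by (subst sum.lessThan_Suc_shift) (simp add: next_mean_def)
    also have "\<dots> = (\<integral>\<^sup>+e. in_gap A (fst z) (snd z) e + (\<Sum>k<n. ?P k (clock_step z e)) \<partial>\<nu>)"
      unfolding gap_mean_def[of A z] by (simp add: nn_integral_add nn_integral_sum)
    also have "\<dots> \<le> (\<integral>\<^sup>+e. (if 0 \<le> fst z then 1 else 0) \<partial>\<nu>)"
    proof (rule nn_integral_mono_AE)
      show "AE e in \<nu>. in_gap A (fst z) (snd z) e + (\<Sum>k<n. ?P k (clock_step z e))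
                      \<le> (if 0 \<le> fst z then 1 else 0)"
        using law_nonneg
      proof eventually_elim
        case (elim e)
        have "(\<Sum>k<n. ?P k (clock_step z e)) \<le> (if fst e \<le> fst z then 1 else 0)"
          using Suc.IH[of "clock_step z e"] fst_clock_step[of z e] by simp
        from add_mono[OF in_gap_le this, of A "fst z" "snd z" e] show ?case
          using elim by (auto split: if_splits)
      qed
    qed
    also have "\<dots> = (if 0 \<le> fst z then 1 else 0)" by (simp add: emeasure_space_1)
    finally show ?case .
  qed simp
  from this[of "(s, C)"] show ?thesis
    unfolding occupation_def suminf_eq_SUP by (intro SUP_least) simp
qed

lemma occupation_neg: "A \<in> sets borel \<Longrightarrow> s < 0 \<Longrightarrow> occupation A s C = 0"
  using occupation_le[of A s C] by simp

lemma flow_le_1: "A \<in> sets borel \<Longrightarrow> flow A s C e \<le> 1"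
  using in_gap_le[of A s C e] occupation_le[of A "s - fst e" "next_arrival_state C e"]
  unfolding flow_def by (cases "s < fst e") (auto split: if_splits simp: in_gap_def)

text \<open>
  The transition function of the queue.  Until the first arrival the motion is deterministic; the
  first customer then sees the work \<open>c\<close> both as left limit and as current work.
\<close>
definition transition :: "(real \<times> real) set \<Rightarrow> real \<Rightarrow> real \<times> real \<Rightarrow> ennreal" where
  "transition A t x =
     (if t < fst x then indicator A (fst x - t, max 0 (snd x - t))
      else let c = max 0 (snd x - fst x) in occupation A (t - fst x) (c, c))"

lemma transition_measurable [measurable (raw)]:
  assumes [measurable]: "A \<in> sets borel" "f \<in> borel_measurable N" "g \<in> borel_measurable N"
  shows "(\<lambda>x. transition A (f x) (g x)) \<in> borel_measurable N"
  unfolding transition_def Let_def by measurable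

lemma transition_le_1: "A \<in> sets borel \<Longrightarrow> transition A t x \<le> 1"
  using occupation_le[of A "t - fst x"] unfolding transition_def Let_def
  by (auto simp: indicator_def split: if_splits)

text \<open>
  The flow property of the queue: a queue started from the state reached at time \<open>s\<close> inside a gap
  and run for a time \<open>t\<close> behaves like the original one at time \<open>s + t\<close>.
\<close>

lemma transition_from_gap:
  assumes A: "A \<in> sets borel" and s: "0 \<le> s" "s < fst e" "0 \<le> t"
  shows "transition A t (fst e - s, max 0 (work_after C e - s)) = flow A (s + t) C e"
proof -
  have 1: "max 0 (max 0 (work_after C e - s) - t) = max 0 (work_after C e - (s + t))"
    "t - (fst e - s) = s + t - fst e"
    using s by auto
  have 2: "max 0 (max 0 (work_after C e - s) - (fst e - s)) = max 0 (work_after C e - fst e)"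
    using s by auto
  show ?thesis
  proof (cases "t < fst e - s")
    case True
    then show ?thesis using s A
      by (simp add: transition_def flow_def in_gap_def occupation_neg 1(1) diff_diff_eq)
  next
    case False
    then have "in_gap A (s + t) C e = 0" using s by (simp add: in_gap_def)
    moreover have "next_arrival_state C e = (max 0 (work_after C e - fst e), max 0 (work_after C e - fst e))"
      using s by (simp add: next_arrival_state_def Let_def)
    ultimately show ?thesis using False
      by (simp add: transition_def flow_def 2 1(2) Let_def)
  qed
qed

end

section \<open>Mean time to find the queue empty\<close>

text \<open>
  The state \<open>(0, 0)\<close> of a customer who finds an empty queue is a regeneration point.  The operator
  \<open>taboo\<close> is the transition operator of the chain killed on reaching it, so that
  \<open>(taboo ^^ n) (\<lambda>_. 1) C\<close> is the probability of avoiding \<open>(0, 0)\<close> during \<open>n\<close> steps from \<open>C\<close>,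
  and the sum over \<open>n\<close> is the mean hitting time.
\<close>
context customer_law
begin

definition taboo :: "(real \<times> real \<Rightarrow> ennreal) \<Rightarrow> real \<times> real \<Rightarrow> ennreal" where
  "taboo \<phi> C = (\<integral>\<^sup>+e. \<phi> (next_arrival_state C e) * indicator (- {(0, 0)}) (next_arrival_state C e) \<partial>\<nu>)"

lemma taboo_mono: "(\<And>C. 0 \<le> snd C \<Longrightarrow> \<phi> C \<le> \<psi> C) \<Longrightarrow> taboo \<phi> C \<le> taboo \<psi> C"
  unfolding taboo_def
  by (intro nn_integral_mono mult_right_mono) (auto simp: snd_next_arrival_state_nonneg)

lemma taboo_measurable [measurable]:
  assumes [measurable]: "\<phi> \<in> borel_measurable borel" shows "taboo \<phi> \<in> borel_measurable borel"
  unfolding taboo_def by measurable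

lemma taboo_pow_measurable [measurable]:
  assumes [measurable]: "\<phi> \<in> borel_measurable borel" shows "(taboo ^^ n) \<phi> \<in> borel_measurable borel"
  by (induction n) simp_all

lemma taboo_sum:
  assumes [measurable]: "\<And>k. \<phi> k \<in> borel_measurable borel"
  shows "taboo (\<lambda>C. \<Sum>k\<in>I. \<phi> k C) C = (\<Sum>k\<in>I. taboo (\<phi> k) C)"
proof -
  have "(\<lambda>e. \<phi> k (next_arrival_state C e) * indicator (- {(0, 0)}) (next_arrival_state C e))
      \<in> borel_measurable \<nu>" for k
    by measurable
  then show ?thesis unfolding taboo_def sum_distrib_right by (intro nn_integral_sum) auto
qed

text \<open>
  Foster's criterion for the killed chain: a function that decreases by at least 1 in the mean bounds
  the mean hitting time.
\<close>

lemma taboo_sum_bound: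
  assumes super: "\<And>C. 0 \<le> snd C \<Longrightarrow> 1 + taboo g C \<le> g C" and C: "0 \<le> snd C"
  shows "(\<Sum>n. (taboo ^^ n) (\<lambda>_. 1) C) \<le> g C"
proof -
  let ?Q = "\<lambda>n. (taboo ^^ n) (\<lambda>_. 1)"
  have "(\<Sum>k<n. ?Q k C) \<le> g C" if "0 \<le> snd C" for n C
    using that
  proof (induction n arbitrary: C)
    case (Suc n)
    have [measurable]: "?Q k \<in> borel_measurable borel" for k by simp
    have "(\<Sum>k<Suc n. ?Q k C) = 1 + (\<Sum>k<n. taboo (?Q k) C)"
      by (subst sum.lessThan_Suc_shift) simp
    also have "(\<Sum>k<n. taboo (?Q k) C) = taboo (\<lambda>C. \<Sum>k<n. ?Q k C) C"
      by (simp add: taboo_sum)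
    also have "\<dots> \<le> taboo g C" by (intro taboo_mono Suc.IH)
    finally show ?case using super[OF Suc.prems] by (meson add_left_mono order_trans)
  qed simp
  then show ?thesis using C unfolding suminf_eq_SUP by (intro SUP_least) simp
qed

end

text \<open>
  The two properties behind stability.  \<open>drift\<close>: customers who see a left limit of at least \<open>b\<close>
  bring on average less work than is served until the next arrival.  \<open>clearing\<close>: an interarrival
  time exceeds any fixed amount of work plus one service with positive probability, so that the queue
  can empty within one step.
\<close>

locale stable_customer_law = customer_law \<nu> for \<nu> +
  fixes b :: real
  assumes mean_interarrival: "integrable \<nu> fst"
    and mean_service: "integrable \<nu> (\<lambda>e. fst (snd e))"
    and drift: "(\<integral>e. fst (snd e) * of_bool (b < snd (snd e)) \<partial>\<nu>) < (\<integral>e. fst e \<partial>\<nu>)"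
    and clearing: "\<And>B. 0 \<le> B \<Longrightarrow> 0 < prob {e \<in> space \<nu>. B + fst (snd e) < fst e}"
    and b_nonneg: "0 \<le> b"
begin

lemma mean_pos: "0 < (\<integral>e. fst e \<partial>\<nu>)"
proof -
  have "0 \<le> (\<integral>e. fst (snd e) * of_bool (b < snd (snd e)) \<partial>\<nu>)"
    by (rule integral_nonneg_AE) (use law_nonneg in eventually_elim, auto)
  then show ?thesis using drift by linarith
qed

text \<open>
  The function is \<open>w + \<kappa> [l < b] + G\<close>.
  For \<open>w\<close> above a large level \<open>B\<close> and \<open>l \<ge> b\<close> the drift condition makes \<open>w\<close> decrease in the
  mean.  The mean of \<open>w\<close> may increase as long as \<open>l < b \<le> w\<close>, which happens while
  customers keep arriving at the same epoch; but such a batch ends with a positive probability at each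
  step, and then the drop of \<open>\<kappa>\<close> compensates the increase.  For \<open>w < B\<close> the chain is killed at
  \<open>(0, 0)\<close> with probability at least \<open>\<delta>\<close>, which removes \<open>G \<delta>\<close> from the mean and outweighs
  the bounded increase once \<open>G\<close> is large.
\<close>

lemma exists_lyapunov:
  obtains \<kappa> B \<epsilon> G :: real where "0 \<le> \<kappa>" "0 < \<epsilon>" "0 \<le> G"
    "\<And>C. 0 \<le> snd C \<Longrightarrow>
      (\<integral>\<^sup>+e. ennreal (snd (next_arrival_state C e) + \<kappa> * of_bool (fst (next_arrival_state C e) < b) + G)
          * indicator (- {(0, 0)}) (next_arrival_state C e) \<partial>\<nu>) + ennreal \<epsilon>
        \<le> ennreal (snd C + \<kappa> * of_bool (fst C < b) + G)"
proof -
  have [measurable]: "fst \<in> borel_measurable \<nu>" "(\<lambda>e. fst (snd e)) \<in> borel_measurable \<nu>"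
    "(\<lambda>e. snd (snd e)) \<in> borel_measurable \<nu>" by measurable
  define Ea Es q where "Ea = (\<integral>e. fst e \<partial>\<nu>)" and "Es = (\<integral>e. fst (snd e) \<partial>\<nu>)"
    and "q = (\<integral>e. fst (snd e) * of_bool (b < snd (snd e)) \<partial>\<nu>)"
  define p0 :: real where "p0 = (\<integral>e. of_bool (fst e \<le> 0) \<partial>\<nu>)"
  note int = mean_interarrival mean_service
  have int_q: "integrable \<nu> (\<lambda>e. fst (snd e) * of_bool (b < snd (snd e)))"
    by (rule Bochner_Integration.integrable_bound[OF mean_service]) (auto intro!: AE_I2)
  have int_bool: "integrable \<nu> (\<lambda>e. of_bool (P e) :: real)" if [measurable]: "Measurable.pred \<nu> P" for P
    by (rule integrable_const_bound[where B=1]) (auto simp: of_bool_def)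
  have int_prob: "(\<integral>e. of_bool (P e) \<partial>\<nu>) = prob {e \<in> space \<nu>. P e}" for P
  proof -
    have "(\<lambda>e. of_bool (P e) :: real) = indicator {e. P e}" by (auto simp: indicator_def)
    moreover have "{e. P e} \<inter> space \<nu> = {e \<in> space \<nu>. P e}" by auto
    ultimately show ?thesis by simp
  qed
  have Es0: "0 \<le> Es" unfolding Es_def by (rule integral_nonneg_AE) (use law_nonneg in eventually_elim, auto)
  have p0: "p0 < 1"
  proof -
    have "p0 \<le> 1"
      unfolding p0_def using integral_mono[OF int_bool[of "\<lambda>e. fst e \<le> 0"] integrable_const[of 1]] prob_space by simp
    moreover have "p0 \<noteq> 1"
    proof
      assume "p0 = 1"
      then have "prob {e \<in> space \<nu>. fst e \<le> 0} = 1"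
        unfolding p0_def int_prob .
      then have "AE e in \<nu>. fst e \<le> 0" by (subst (asm) prob_Collect_eq_1) auto
      then have "(\<integral>e. fst e \<partial>\<nu>) \<le> (\<integral>e. 0 \<partial>\<nu>)" by (intro integral_mono_AE int) auto
      then show False using mean_pos by simp
    qed
    ultimately show ?thesis by simp
  qed
  define \<kappa> where "\<kappa> = (Es + 2) / (1 - p0)"
  define \<epsilon> where "\<epsilon> = min ((Ea - q) / 2) 1"
  have \<kappa>: "0 \<le> \<kappa>" "\<kappa> * p0 + Es + 2 = \<kappa>" using p0 Es0 by (auto simp: \<kappa>_def field_simps)
  have \<epsilon>: "0 < \<epsilon>" "\<epsilon> \<le> 1" "2 * \<epsilon> \<le> Ea - q" using drift by (auto simp: \<epsilon>_def Ea_def q_def min_def field_simps)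
  \<comment> \<open>The two errors for \<open>w \<ge> B\<close>: idling of the server and a fall of the workload below \<open>b\<close>.\<close>
  define err where "err B e = max 0 (fst e - B) + \<kappa> * of_bool (B - b < fst e)" for B :: real and e :: "real \<times> real \<times> real"
  have int_max: "integrable \<nu> (\<lambda>e. max 0 (fst e - B))" for B
    by (intro Bochner_Integration.integrable_max integrable_const Bochner_Integration.integrable_diff int)
  have int_err: "integrable \<nu> (err B)" for B
    unfolding err_def
    by (intro Bochner_Integration.integrable_add integrable_mult_right int_bool int_max) measurable
  have err0: "(\<lambda>n. \<integral>e. err (real n) e \<partial>\<nu>) \<longlonglongrightarrow> (\<integral>e. 0 \<partial>\<nu>)"
  proof (rule integral_dominated_convergence[where w = "\<lambda>e. fst e + \<kappa>"])
    show "AE e in \<nu>. (\<lambda>n. err (real n) e) \<longlonglongrightarrow> 0"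
    proof (rule AE_I2)
      fix e :: "real \<times> real \<times> real"
      obtain N where N: "fst e + b < real N" using reals_Archimedean2 by blast
      \<comment> \<open>For fixed \<open>e\<close> both errors vanish once the level exceeds \<open>fst e + b\<close>.\<close>
      have "eventually (\<lambda>n. err (real n) e = 0) sequentially"
        using eventually_ge_at_top[of N]
      proof eventually_elim
        case (elim n)
        then have "real N \<le> real n" by simp
        then show ?case using N b_nonneg by (auto simp: err_def)
      qed
      then show "(\<lambda>n. err (real n) e) \<longlonglongrightarrow> 0" by (rule tendsto_eventually)
    qed
    show "AE e in \<nu>. norm (err (real n) e) \<le> fst e + \<kappa>" for n
      using law_nonneg by eventually_elim (use \<kappa> in \<open>auto simp: err_def of_bool_def\<close>)
    show "integrable \<nu> (\<lambda>e. fst e + \<kappa>)" using int by auto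
    show "err (real n) \<in> borel_measurable \<nu>" for n using int_err by (rule borel_measurable_integrable)
  qed simp
  then obtain n where "(\<integral>e. err (real n) e \<partial>\<nu>) < \<epsilon>"
    using order_tendstoD(2)[OF err0, of \<epsilon>] \<epsilon>(1) by (auto simp: eventually_sequentially)
  then obtain B where B: "0 \<le> B" "(\<integral>e. err B e \<partial>\<nu>) < \<epsilon>" by (metis of_nat_0_le_iff)
  define \<delta> where "\<delta> = prob {e \<in> space \<nu>. B + fst (snd e) < fst e}"
  have \<delta>: "0 < \<delta>" using clearing[OF B(1)] by (simp add: \<delta>_def)
  have int_\<delta>: "(\<integral>e. of_bool (B + fst (snd e) < fst e) \<partial>\<nu>) = \<delta>"
    unfolding \<delta>_def int_prob ..
  define G where "G = (Es + \<kappa> + \<epsilon>) / \<delta>"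
  have G: "0 \<le> G" "G * \<delta> = Es + \<kappa> + \<epsilon>" using \<delta> Es0 \<kappa> \<epsilon> by (auto simp: G_def)
  let ?f = "\<lambda>C. snd C + \<kappa> * of_bool (fst C < b) + G"
  \<comment> \<open>It suffices to bound the integrand by an integrable function with the right mean.\<close>
  have main: "(\<integral>\<^sup>+e. ennreal (?f (next_arrival_state C e))
          * indicator (- {(0, 0)}) (next_arrival_state C e) \<partial>\<nu>) + ennreal \<epsilon> \<le> ennreal (?f C)"
    if h: "integrable \<nu> h" "(\<integral>e. h e \<partial>\<nu>) + \<epsilon> \<le> ?f C"
     "AE e in \<nu>. 0 \<le> h e \<and> (next_arrival_state C e \<noteq> (0, 0) \<longrightarrow> ?f (next_arrival_state C e) \<le> h e)"
     for h C
  proof -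
    have "(\<integral>\<^sup>+e. ennreal (?f (next_arrival_state C e)) * indicator (- {(0, 0)}) (next_arrival_state C e) \<partial>\<nu>)
        \<le> (\<integral>\<^sup>+e. ennreal (h e) \<partial>\<nu>)"
      by (rule nn_integral_mono_AE, use h(3) in eventually_elim) (auto simp: indicator_def ennreal_leI)
    also have "\<dots> = ennreal (\<integral>e. h e \<partial>\<nu>)"
      using h by (intro nn_integral_eq_integral) auto
    finally have "(\<integral>\<^sup>+e. ennreal (?f (next_arrival_state C e)) * indicator (- {(0, 0)}) (next_arrival_state C e) \<partial>\<nu>)
       + ennreal \<epsilon> \<le> ennreal (\<integral>e. h e \<partial>\<nu>) + ennreal \<epsilon>" by (rule add_right_mono)
    also have "\<dots> = ennreal ((\<integral>e. h e \<partial>\<nu>) + \<epsilon>)"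
      using h(3) \<epsilon> by (intro ennreal_plus[symmetric] integral_nonneg_AE) auto
    also have "\<dots> \<le> ennreal (?f C)" using h(2) by (rule ennreal_leI)
    finally show ?thesis .
  qed
  have next_w: "snd (next_arrival_state C e) = max 0 (work_after C e - fst e)" for C e
    by (simp add: next_arrival_state_def Let_def)
  have next_l: "fst (next_arrival_state C e) < b \<Longrightarrow> 0 \<le> fst (snd e) \<Longrightarrow> B \<le> snd C \<Longrightarrow>
      B - b < fst e \<or> (fst e \<le> 0 \<and> fst C < b)" for C e
    by (cases "0 < fst e")
       (auto simp: next_arrival_state_def Let_def work_after_eq of_bool_def split: if_splits)
  have bound: "(\<integral>\<^sup>+e. ennreal (?f (next_arrival_state C e))
          * indicator (- {(0, 0)}) (next_arrival_state C e) \<partial>\<nu>) + ennreal \<epsilon> \<le> ennreal (?f C)"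
    if C: "0 \<le> snd C" for C
  proof -
    consider "snd C < B" | "B \<le> snd C" "fst C < b" | "B \<le> snd C" "b \<le> fst C" by linarith
    then show ?thesis
    proof cases
      case 1
      let ?h = "\<lambda>e. snd C + fst (snd e) + \<kappa> + G - G * of_bool (B + fst (snd e) < fst e)"
      show ?thesis
      proof (rule main[of ?h])
        show "integrable \<nu> ?h" by (intro Bochner_Integration.integrable_add Bochner_Integration.integrable_diff
              integrable_const integrable_mult_right int int_bool) measurable
        have "(\<integral>e. ?h e \<partial>\<nu>) = snd C + Es + \<kappa> + G - G * \<delta>"
          using int int_bool[of "\<lambda>e. B + fst (snd e) < fst e"] prob_space
          by (simp add: Es_def int_\<delta>)
        then show "(\<integral>e. ?h e \<partial>\<nu>) + \<epsilon> \<le> ?f C" using G \<kappa> by auto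
        show "AE e in \<nu>. 0 \<le> ?h e \<and> (next_arrival_state C e \<noteq> (0, 0) \<longrightarrow> ?f (next_arrival_state C e) \<le> ?h e)"
          using law_nonneg
        proof eventually_elim
          case (elim e)
          have w: "work_after C e \<le> snd C + fst (snd e)" using elim by (simp add: work_after_eq of_bool_def)
          have z: "next_arrival_state C e = (0, 0)" if "B + fst (snd e) < fst e"
            using that w 1 elim B by (auto simp: next_arrival_state_def Let_def)
          have "?f (next_arrival_state C e) \<le> snd C + fst (snd e) + \<kappa> + G"
            unfolding next_w using w elim C \<kappa> by (auto simp: of_bool_def)
          then show ?case using z elim C \<kappa> G by (auto simp: of_bool_def)
        qed
      qed
    next
      case 2
      let ?h = "\<lambda>e. snd C + fst (snd e) + \<kappa> * of_bool (fst e \<le> 0) + err B e + G"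
      show ?thesis
      proof (rule main[of ?h])
        show "integrable \<nu> ?h" by (intro Bochner_Integration.integrable_add int_err
              integrable_const integrable_mult_right int int_bool) measurable
        have "(\<integral>e. ?h e \<partial>\<nu>) = snd C + Es + \<kappa> * p0 + (\<integral>e. err B e \<partial>\<nu>) + G"
          using int int_bool[of "\<lambda>e. fst e \<le> 0"] int_err[of B] prob_space
          by (simp add: Es_def p0_def)
        then show "(\<integral>e. ?h e \<partial>\<nu>) + \<epsilon> \<le> ?f C" using B \<kappa> \<epsilon> 2 by auto
        show "AE e in \<nu>. 0 \<le> ?h e \<and> (next_arrival_state C e \<noteq> (0, 0) \<longrightarrow> ?f (next_arrival_state C e) \<le> ?h e)"
          using law_nonneg
        proof eventually_elim
          case (elim e)
          have w: "work_after C e \<le> snd C + fst (snd e)" using elim by (simp add: work_after_eq of_bool_def)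
          have "?f (next_arrival_state C e) \<le> ?h e"
            unfolding next_w using next_l[of C e] w elim C \<kappa> 2 by (auto simp: of_bool_def err_def)
          then show ?case using elim C \<kappa> G by (auto simp: err_def)
        qed
      qed
    next
      case 3
      let ?h = "\<lambda>e. snd C + fst (snd e) * of_bool (b < snd (snd e)) - fst e + err B e + G"
      show ?thesis
      proof (rule main[of ?h])
        show "integrable \<nu> ?h" by (intro Bochner_Integration.integrable_add Bochner_Integration.integrable_diff
              int_err int_q integrable_const int)
        have "(\<integral>e. ?h e \<partial>\<nu>) = snd C + q - Ea + (\<integral>e. err B e \<partial>\<nu>) + G"
          using int int_q int_err[of B] prob_space
          by (simp add: q_def Ea_def)
        then show "(\<integral>e. ?h e \<partial>\<nu>) + \<epsilon> \<le> ?f C" using B \<kappa> \<epsilon> 3 by auto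
        show "AE e in \<nu>. 0 \<le> ?h e \<and> (next_arrival_state C e \<noteq> (0, 0) \<longrightarrow> ?f (next_arrival_state C e) \<le> ?h e)"
          using law_nonneg
        proof eventually_elim
          case (elim e)
          have w: "work_after C e \<le> snd C + fst (snd e) * of_bool (b < snd (snd e))"
            using elim 3 by (simp add: work_after_eq of_bool_def)
          have s: "0 \<le> fst (snd e) * of_bool (b < snd (snd e))" using elim by (auto simp: of_bool_def)
          have "max 0 (work_after C e - fst e) \<le> snd C + fst (snd e) * of_bool (b < snd (snd e)) - fst e + max 0 (fst e - B)"
            using w s 3 by linarith
          moreover have "\<kappa> * of_bool (fst (next_arrival_state C e) < b) \<le> \<kappa> * of_bool (B - b < fst e)"
            using next_l[of C e] elim 3 \<kappa> by (auto simp: of_bool_def)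
          ultimately have "?f (next_arrival_state C e) \<le> ?h e"
            unfolding next_w err_def by linarith
          moreover have "0 \<le> ?f (next_arrival_state C e)" unfolding next_w using \<kappa> G by auto
          ultimately show ?case by linarith
        qed
      qed
    qed
  qed
  show thesis by (rule that[OF \<kappa>(1) \<epsilon>(1) G(1) bound])
qed

lemma taboo_sum_finite:
  assumes "0 \<le> snd C" shows "(\<Sum>n. (taboo ^^ n) (\<lambda>_. 1) C) < \<infinity>"
proof -
  obtain \<kappa> \<epsilon> G where *: "0 \<le> \<kappa>" "0 < \<epsilon>" "0 \<le> G"
    "\<And>C. 0 \<le> snd C \<Longrightarrow>
      (\<integral>\<^sup>+e. ennreal (snd (next_arrival_state C e) + \<kappa> * of_bool (fst (next_arrival_state C e) < b) + G)
          * indicator (- {(0, 0)}) (next_arrival_state C e) \<partial>\<nu>) + ennreal \<epsilon>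
        \<le> ennreal (snd C + \<kappa> * of_bool (fst C < b) + G)"
    by (rule exists_lyapunov) (rule that)
  define f where "f C = ennreal (snd C + \<kappa> * of_bool (fst C < b) + G)" for C
  have [measurable]: "f \<in> borel_measurable borel" unfolding f_def by measurable
  define g where "g C = ennreal (1 / \<epsilon>) * f C" for C
  have "1 + taboo g C \<le> g C" if "0 \<le> snd C" for C
  proof -
    have "taboo g C = ennreal (1 / \<epsilon>) * taboo f C"
      unfolding taboo_def g_def mult.assoc by (rule nn_integral_cmult) measurable
    moreover have "(1::ennreal) = ennreal (1 / \<epsilon>) * ennreal \<epsilon>" using *(2) by (simp flip: ennreal_mult)
    ultimately have "1 + taboo g C = ennreal (1 / \<epsilon>) * (taboo f C + ennreal \<epsilon>)"
      by (simp add: distrib_left add.commute)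
    also have "\<dots> \<le> g C"
      unfolding g_def using *(4)[OF that] by (intro mult_left_mono) (simp_all add: f_def taboo_def)
    finally show ?thesis .
  qed
  from taboo_sum_bound[of g C, OF this assms] have "(\<Sum>n. (taboo ^^ n) (\<lambda>_. 1) C) \<le> g C" .
  also have "g C < \<infinity>" by (simp add: g_def f_def ennreal_mult_less_top)
  finally show ?thesis .
qed

end

section \<open>The invariant measure of the chain at arrivals\<close>

lemma ennreal_suminf_finite_imp_LIMSEQ_zero:
  fixes f :: "nat \<Rightarrow> ennreal"
  assumes "(\<Sum>k. f k) < \<infinity>" shows "f \<longlonglongrightarrow> 0"
proof -
  have "f k < \<infinity>" for k
    using sum_le_suminf[of f "{k}"] assms by (auto intro: le_less_trans)
  then have f: "f = (\<lambda>k. ennreal (enn2real (f k)))" by auto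
  then have "(\<Sum>k. ennreal (enn2real (f k))) \<noteq> top" using assms by auto
  then have "summable (\<lambda>k. enn2real (f k))" by (intro summable_suminf_not_top) auto
  then have "(\<lambda>k. ennreal (enn2real (f k))) \<longlonglongrightarrow> ennreal 0"
    by (intro tendsto_ennrealI summable_LIMSEQ_zero)
  then show ?thesis using f by simp
qed

context customer_law
begin

text \<open>
  The law of the chain started at the regeneration point, after \<open>k\<close> steps and restricted to the event
  that it has not returned.
\<close>

primrec taboo_law :: "nat \<Rightarrow> (real \<times> real) measure" where
  "taboo_law 0 = return borel (0, 0)"
| "taboo_law (Suc k) =
     distr (density (taboo_law k \<Otimes>\<^sub>M \<nu>)
             (\<lambda>x. indicator (- {(0, 0)}) (next_arrival_state (fst x) (snd x))))
       borel (\<lambda>x. next_arrival_state (fst x) (snd x))"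

lemma sets_taboo_law [measurable_cong]: "sets (taboo_law k) = sets borel"
  by (cases k) simp_all

lemma space_taboo_law [simp]: "space (taboo_law k) = UNIV"
  using sets_eq_imp_space_eq[OF sets_taboo_law] by simp

lemma nn_integral_taboo_law_Suc:
  assumes [measurable]: "\<phi> \<in> borel_measurable borel"
  shows "(\<integral>\<^sup>+C. \<phi> C \<partial>taboo_law (Suc k)) = (\<integral>\<^sup>+C. taboo \<phi> C \<partial>taboo_law k)"
  unfolding taboo_def
  by (simp add: nn_integral_distr nn_integral_density nn_integral_fst[symmetric] mult.commute)

lemma nn_integral_taboo_law:
  assumes "\<phi> \<in> borel_measurable borel"
  shows "(\<integral>\<^sup>+C. \<phi> C \<partial>taboo_law k) = (taboo ^^ k) \<phi> (0, 0)"
  using assms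
proof (induction k arbitrary: \<phi>)
  case 0 then show ?case by (simp add: nn_integral_return)
next
  case (Suc k)
  then show ?case by (simp add: nn_integral_taboo_law_Suc funpow_swap1 del: taboo_law.simps)
qed

text \<open>
  A step of the chain is split according to whether it ends in \<open>(0, 0)\<close>.
\<close>

lemma taboo_plus_return:
  assumes [measurable]: "\<phi> \<in> borel_measurable borel"
  shows "(\<integral>\<^sup>+e. \<phi> (next_arrival_state C e) \<partial>\<nu>)
     = taboo \<phi> C + \<phi> (0, 0) * (\<integral>\<^sup>+e. indicator {(0, 0)} (next_arrival_state C e) \<partial>\<nu>)"
proof -
  have "(\<integral>\<^sup>+e. \<phi> (next_arrival_state C e) \<partial>\<nu>)
      = (\<integral>\<^sup>+e. \<phi> (next_arrival_state C e) * indicator (- {(0, 0)}) (next_arrival_state C e)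
            + \<phi> (0, 0) * indicator {(0, 0)} (next_arrival_state C e) \<partial>\<nu>)"
    by (intro nn_integral_cong) (auto simp: indicator_def)
  then show ?thesis unfolding taboo_def by (simp add: nn_integral_add nn_integral_cmult)
qed

lemma taboo_one_le: "taboo (\<lambda>_. 1) C \<le> 1"
proof -
  have "1 = taboo (\<lambda>_. 1) C + (\<integral>\<^sup>+e. indicator {(0, 0)} (next_arrival_state C e) \<partial>\<nu>)"
    using taboo_plus_return[of "\<lambda>_. 1" C] by (simp add: emeasure_space_1)
  then show ?thesis by (metis le_iff_add)
qed

lemma subprob_space_taboo_law: "subprob_space (taboo_law k)"
proof (rule subprob_spaceI)
  have "(\<integral>\<^sup>+C. 1 \<partial>taboo_law k) \<le> 1"
  proof (induction k)
    case (Suc k)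
    have "(\<integral>\<^sup>+C. 1 \<partial>taboo_law (Suc k)) \<le> (\<integral>\<^sup>+C. 1 \<partial>taboo_law k)"
      unfolding nn_integral_taboo_law_Suc[OF borel_measurable_const]
      by (rule nn_integral_mono) (rule taboo_one_le)
    then show ?case using Suc by (rule order_trans)
  qed (simp add: nn_integral_return)
  then show "emeasure (taboo_law k) (space (taboo_law k)) \<le> 1" by simp
qed simp

text \<open>
  The expected number of visits during one excursion from \<open>(0, 0)\<close>: the sum of the measures
  \<open>taboo_law k\<close>, written as a mixture over the counting measure.
\<close>

definition cycle_law :: "(real \<times> real) measure" where
  "cycle_law = count_space UNIV \<bind> taboo_law"

lemma taboo_law_kernel: "taboo_law \<in> count_space UNIV \<rightarrow>\<^sub>M subprob_algebra borel"
  by (auto simp: space_subprob_algebra subprob_space_taboo_law sets_taboo_law)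

lemma sets_cycle_law [measurable_cong]: "sets cycle_law = sets borel"
  unfolding cycle_law_def by (rule sets_bind[OF sets_kernel[OF taboo_law_kernel]]) auto

lemma space_cycle_law [simp]: "space cycle_law = UNIV"
  using sets_eq_imp_space_eq[OF sets_cycle_law] by simp

lemma nn_integral_cycle_law:
  assumes "\<phi> \<in> borel_measurable borel"
  shows "(\<integral>\<^sup>+C. \<phi> C \<partial>cycle_law) = (\<Sum>k. \<integral>\<^sup>+C. \<phi> C \<partial>taboo_law k)"
  unfolding cycle_law_def
  by (simp add: nn_integral_bind[OF assms taboo_law_kernel] nn_integral_count_space_nat)

end

context stable_customer_law
begin

lemma emeasure_cycle_law:
  "emeasure cycle_law UNIV = (\<Sum>k. (taboo ^^ k) (\<lambda>_. 1) (0, 0))"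
  using nn_integral_cycle_law[of "\<lambda>_. 1"] by (simp add: nn_integral_taboo_law del: nn_integral_const)
     (simp add: nn_integral_taboo_law[symmetric])

lemma emeasure_cycle_law_finite: "emeasure cycle_law UNIV < \<infinity>"
  unfolding emeasure_cycle_law by (rule taboo_sum_finite) simp

lemma emeasure_cycle_law_ge_1: "1 \<le> emeasure cycle_law UNIV"
  unfolding emeasure_cycle_law
  using sum_le_suminf[of "\<lambda>k. (taboo ^^ k) (\<lambda>_. 1) (0, 0)" "{0}"] by simp

text \<open>
  The excursion ends with probability one: the mass lost at each killing step telescopes to
  \<open>1 - (mass after n steps)\<close>, and the latter tends to 0 because its sum over \<open>n\<close> is finite.
\<close>
lemma total_return_probability:
  "(\<integral>\<^sup>+C. (\<integral>\<^sup>+e. indicator {(0, 0)} (next_arrival_state C e) \<partial>\<nu>) \<partial>cycle_law) = 1"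
proof -
  let ?\<rho> = "\<lambda>C. \<integral>\<^sup>+e. indicator {(0, 0)} (next_arrival_state C e) \<partial>\<nu>"
  let ?m = "\<lambda>k. \<integral>\<^sup>+C. 1 \<partial>taboo_law k"
  have [measurable]: "?\<rho> \<in> borel_measurable borel" by measurable
  have step: "?m k = ?m (Suc k) + (\<integral>\<^sup>+C. ?\<rho> C \<partial>taboo_law k)" for k
  proof -
    have "?m k = (\<integral>\<^sup>+C. taboo (\<lambda>_. 1) C + ?\<rho> C \<partial>taboo_law k)"
      using taboo_plus_return[of "\<lambda>_. 1"] by (intro nn_integral_cong) (simp add: emeasure_space_1)
    also have "\<dots> = ?m (Suc k) + (\<integral>\<^sup>+C. ?\<rho> C \<partial>taboo_law k)"
      by (subst nn_integral_taboo_law_Suc) (auto simp: nn_integral_add)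
    finally show ?thesis .
  qed
  have partial: "(\<Sum>k<n. \<integral>\<^sup>+C. ?\<rho> C \<partial>taboo_law k) + ?m n = 1" for n
  proof (induction n)
    case 0 then show ?case by (simp add: nn_integral_return)
  next
    case (Suc n)
    then show ?case using step[of n] by (simp only: sum.lessThan_Suc ac_simps)
  qed
  have "?m \<longlonglongrightarrow> 0"
    using emeasure_cycle_law_finite nn_integral_cycle_law[of "\<lambda>_. 1"]
    by (intro ennreal_suminf_finite_imp_LIMSEQ_zero) (simp del: taboo_law.simps)
  then have "(\<lambda>n. (\<Sum>k<n. \<integral>\<^sup>+C. ?\<rho> C \<partial>taboo_law k) + ?m n) \<longlonglongrightarrow> (\<Sum>k. \<integral>\<^sup>+C. ?\<rho> C \<partial>taboo_law k) + 0"
    by (intro tendsto_add summable_LIMSEQ) auto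
  then have "(\<Sum>k. \<integral>\<^sup>+C. ?\<rho> C \<partial>taboo_law k) = 1"
    unfolding partial by (simp add: LIMSEQ_const_iff)
  then show ?thesis by (simp add: nn_integral_cycle_law)
qed

text \<open>
  Moving an excursion one step ahead shifts its visits by one: the initial visit to \<open>(0, 0)\<close> is lost
  and the return to \<open>(0, 0)\<close> is gained.
\<close>

lemma cycle_law_invariant:
  assumes [measurable]: "\<phi> \<in> borel_measurable borel"
  shows "(\<integral>\<^sup>+C. (\<integral>\<^sup>+e. \<phi> (next_arrival_state C e) \<partial>\<nu>) \<partial>cycle_law) = (\<integral>\<^sup>+C. \<phi> C \<partial>cycle_law)"
proof -
  have "(\<integral>\<^sup>+C. (\<integral>\<^sup>+e. \<phi> (next_arrival_state C e) \<partial>\<nu>) \<partial>cycle_law)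
      = (\<integral>\<^sup>+C. taboo \<phi> C \<partial>cycle_law) + \<phi> (0, 0)"
    unfolding taboo_plus_return[OF assms]
    by (simp add: nn_integral_add nn_integral_cmult total_return_probability)
  also have "(\<integral>\<^sup>+C. taboo \<phi> C \<partial>cycle_law) = (\<Sum>k. \<integral>\<^sup>+C. \<phi> C \<partial>taboo_law (Suc k))"
    by (simp add: nn_integral_cycle_law nn_integral_taboo_law_Suc del: taboo_law.simps)
  also have "\<dots> + \<phi> (0, 0) = (\<integral>\<^sup>+C. \<phi> C \<partial>cycle_law)"
    by (subst nn_integral_cycle_law, simp, subst (2) suminf_offset[of _ 1])
       (auto simp: nn_integral_return add.commute simp del: taboo_law.simps(2))
  finally show ?thesis .
qed

end

section \<open>Existence of a stationary law\<close>

lemma borel_measurable_window_indicator [measurable (raw)]: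
  fixes f g h :: "'a \<Rightarrow> real"
  assumes [measurable]: "f \<in> borel_measurable N" "g \<in> borel_measurable N" "h \<in> borel_measurable N"
  shows "(\<lambda>x. indicator {f x..<g x} (h x) :: ennreal) \<in> borel_measurable N"
proof -
  have "(\<lambda>x. indicator {f x..<g x} (h x) :: ennreal) = (\<lambda>x. if f x \<le> h x \<and> h x < g x then 1 else 0)"
    by (auto simp: indicator_def)
  then show ?thesis by simp
qed

lemma nn_integral_window_shift:
  fixes f :: "real \<Rightarrow> ennreal" and c :: real
  assumes [measurable]: "f \<in> borel_measurable borel"
  shows "(\<integral>\<^sup>+s. f (s + c) * indicator {x..<y} s \<partial>lborel) = (\<integral>\<^sup>+s. f s * indicator {x + c..<y + c} s \<partial>lborel)"
  by (subst nn_integral_real_affine[where t = c and c = 1 and f = "\<lambda>s. f s * indicator {x + c..<y + c} s"])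
     (auto simp: indicator_def add.commute intro!: nn_integral_cong)

lemma nn_integral_window_split:
  fixes f :: "real \<Rightarrow> ennreal"
  assumes [measurable]: "f \<in> borel_measurable borel" and "x \<le> y" "y \<le> z"
  shows "(\<integral>\<^sup>+s. f s * indicator {x..<z} s \<partial>lborel)
     = (\<integral>\<^sup>+s. f s * indicator {x..<y} s \<partial>lborel) + (\<integral>\<^sup>+s. f s * indicator {y..<z} s \<partial>lborel)"
  by (subst nn_integral_add[symmetric])
     (use assms(2,3) in \<open>auto simp: indicator_def intro!: nn_integral_cong\<close>)

lemma nn_integral_window_le:
  fixes f :: "real \<Rightarrow> ennreal"
  assumes "\<And>s. f s \<le> 1" and "x \<le> y"
  shows "(\<integral>\<^sup>+s. f s * indicator {x..<y} s \<partial>lborel) \<le> ennreal (y - x)"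
proof -
  have "(\<integral>\<^sup>+s. f s * indicator {x..<y} s \<partial>lborel) \<le> (\<integral>\<^sup>+s. indicator {x..<y} s \<partial>lborel)"
    by (intro nn_integral_mono) (use assms(1) in \<open>auto simp: indicator_def\<close>)
  then show ?thesis using assms(2) by simp
qed

context customer_law
begin

text \<open>
  The mean time spent in \<open>A\<close> during \<open>[0, T)\<close> after the arrival of a customer who sees \<open>C\<close>.
\<close>

definition occupation_time :: "(real \<times> real) set \<Rightarrow> real \<Rightarrow> real \<times> real \<Rightarrow> ennreal" where
  "occupation_time A T C = (\<integral>\<^sup>+s. occupation A s C * indicator {0..<T} s \<partial>lborel)"

lemma occupation_time_measurable [measurable (raw)]:
  assumes [measurable]: "A \<in> sets borel" "f \<in> borel_measurable N"
  shows "(\<lambda>x. occupation_time A T (f x)) \<in> borel_measurable N"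
  unfolding occupation_time_def by measurable

lemma occupation_time_le:
  assumes "A \<in> sets borel" "0 \<le> T" shows "occupation_time A T C \<le> ennreal T"
proof -
  have "occupation A s C \<le> 1" for s using occupation_le[OF assms(1), of s C] by (simp split: if_splits)
  then show ?thesis
    unfolding occupation_time_def using nn_integral_window_le[of "\<lambda>s. occupation A s C" 0 T] assms(2) by simp
qed

lemma occupation_time_renewal:
  assumes [measurable]: "A \<in> sets borel"
  shows "occupation_time A T C = (\<integral>\<^sup>+e. (\<integral>\<^sup>+s. flow A s C e * indicator {0..<T} s \<partial>lborel) \<partial>\<nu>)"
proof -
  have "pair_sigma_finite \<nu> lborel" by (simp add: pair_sigma_finite_def sigma_finite_measure_axioms lborel.sigma_finite_measure_axioms)
  have "occupation_time A T C = (\<integral>\<^sup>+s. (\<integral>\<^sup>+e. flow A s C e * indicator {0..<T} s \<partial>\<nu>) \<partial>lborel)"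
    unfolding occupation_time_def occupation_renewal[OF assms]
    by (simp add: nn_integral_multc)
  also have "\<dots> = (\<integral>\<^sup>+e. (\<integral>\<^sup>+s. flow A s C e * indicator {0..<T} s \<partial>lborel) \<partial>\<nu>)"
    by (rule pair_sigma_finite.Fubini'[OF \<open>pair_sigma_finite \<nu> lborel\<close>]) measurable
  finally show ?thesis .
qed

text \<open>
  After the first gap the clock restarts with the next customer, so the window \<open>[a, a + t)\<close> carries
  the occupation time of the next state.
\<close>

lemma flow_window_after_gap:
  assumes [measurable]: "A \<in> sets borel" and "0 \<le> fst e" "0 \<le> t"
  shows "(\<integral>\<^sup>+s. flow A s C e * indicator {fst e..<fst e + t} s \<partial>lborel) = occupation_time A t (next_arrival_state C e)"
proof -
  have "(\<integral>\<^sup>+s. flow A s C e * indicator {fst e..<fst e + t} s \<partial>lborel)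
     = (\<integral>\<^sup>+s. flow A (s + fst e) C e * indicator {0..<t} s \<partial>lborel)"
    by (subst nn_integral_window_shift) (auto simp: add.commute)
  also have "\<dots> = occupation_time A t (next_arrival_state C e)"
    unfolding occupation_time_def
    by (intro nn_integral_cong) (auto simp: indicator_def flow_def in_gap_def)
  finally show ?thesis .
qed

text \<open>
  The truncation of the first component at 0 is without effect for \<open>s\<close> in the gap \<open>[0, a)\<close>; it makes
  the map land in the state space for every \<open>s\<close>.
\<close>
definition gap_state :: "real \<times> real \<Rightarrow> real \<times> real \<times> real \<Rightarrow> real \<Rightarrow> real \<times> real" where
  "gap_state C e s = (max 0 (fst e - s), max 0 (work_after C e - s))"

lemma gap_state_measurable [measurable (raw)]:
  assumes [measurable]: "h \<in> borel_measurable N" "f \<in> borel_measurable N" "g \<in> borel_measurable N"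
  shows "(\<lambda>x. gap_state (f x) (g x) (h x)) \<in> borel_measurable N"
  unfolding gap_state_def by measurable

lemma gap_state_in_state_space: "gap_state C e s \<in> state_space"
  by (simp add: gap_state_def state_space_def)

lemma flow_window_in_gap:
  assumes [measurable]: "A \<in> sets borel"
  shows "(\<integral>\<^sup>+s. flow A s C e * indicator {0..<fst e} s \<partial>lborel)
       = (\<integral>\<^sup>+s. indicator A (gap_state C e s) * indicator {0..<fst e} s \<partial>lborel)"
  by (intro nn_integral_cong)
     (auto simp: indicator_def flow_def in_gap_def gap_state_def occupation_neg)

lemma transition_window:
  assumes [measurable]: "A \<in> sets borel" and t: "0 \<le> t"
  shows "(\<integral>\<^sup>+s. transition A t (gap_state C e s) * indicator {0..<fst e} s \<partial>lborel)
       = (\<integral>\<^sup>+s. flow A s C e * indicator {t..<fst e + t} s \<partial>lborel)"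
proof -
  have "(\<integral>\<^sup>+s. transition A t (gap_state C e s) * indicator {0..<fst e} s \<partial>lborel)
      = (\<integral>\<^sup>+s. flow A (s + t) C e * indicator {0..<fst e} s \<partial>lborel)"
    by (intro nn_integral_cong) (use t in \<open>auto simp: indicator_def gap_state_def transition_from_gap\<close>)
  then show ?thesis using nn_integral_window_shift[of "\<lambda>s. flow A s C e" t 0 "fst e"] by simp
qed

definition invariant_law :: "(real \<times> real) measure \<Rightarrow> bool" where
  "invariant_law \<pi> \<longleftrightarrow> prob_space \<pi> \<and> sets \<pi> = sets (restrict_space borel state_space) \<and>
     (\<forall>t\<ge>0. \<forall>A\<in>sets \<pi>. emeasure \<pi> A = (\<integral>\<^sup>+x. transition A t x \<partial>\<pi>))"

end

lemma state_space_borel [measurable]: "state_space \<in> sets borel"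
  unfolding state_space_def by (intro borel_closed closed_Times) auto

lemma sets_state_space_iff: "A \<in> sets (restrict_space borel state_space) \<longleftrightarrow> A \<in> sets borel \<and> A \<subseteq> state_space"
  by (auto simp: sets_restrict_space_iff)

lemma space_of_state_law: "sets \<pi> = sets (restrict_space borel state_space) \<Longrightarrow> space \<pi> = state_space"
  by (drule sets_eq_imp_space_eq) (simp add: space_restrict_space)

context stable_customer_law
begin

definition mean_gap :: real where "mean_gap = (\<integral>e. fst e \<partial>\<nu>)"

lemma nn_integral_gap: "(\<integral>\<^sup>+e. ennreal (fst e) \<partial>\<nu>) = ennreal mean_gap"
  unfolding mean_gap_def
  by (intro nn_integral_eq_integral mean_interarrival) (use law_nonneg in eventually_elim, auto)

text \<open>
  The Palm inversion formula: average the state of the queue over the gap that follows an arrival,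
  where the state seen by the arriving customer is distributed according to the invariant measure of
  the chain.
\<close>

definition palm_measure :: "(real \<times> real) measure" where
  "palm_measure =
     distr (density (cycle_law \<Otimes>\<^sub>M (\<nu> \<Otimes>\<^sub>M lborel)) (\<lambda>x. indicator {0..<fst (fst (snd x))} (snd (snd x))))
       (restrict_space borel state_space) (\<lambda>x. gap_state (fst x) (fst (snd x)) (snd (snd x)))"

lemma sigma_finite_gap: "sigma_finite_measure (\<nu> \<Otimes>\<^sub>M lborel)"
proof -
  interpret pair_sigma_finite \<nu> lborel
    by (simp add: pair_sigma_finite_def sigma_finite_measure_axioms lborel.sigma_finite_measure_axioms)
  show ?thesis by (rule sigma_finite_measure_axioms)
qed

lemma nn_integral_palm_measure:
  assumes [measurable]: "f \<in> borel_measurable borel"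
  shows "(\<integral>\<^sup>+x. f x \<partial>palm_measure)
    = (\<integral>\<^sup>+C. (\<integral>\<^sup>+e. (\<integral>\<^sup>+s. f (gap_state C e s) * indicator {0..<fst e} s \<partial>lborel) \<partial>\<nu>) \<partial>cycle_law)"
proof -
  interpret gap: sigma_finite_measure "\<nu> \<Otimes>\<^sub>M lborel" by (rule sigma_finite_gap)
  have [measurable]: "f \<in> borel_measurable (restrict_space borel state_space)"
    by (rule measurable_restrict_space1) simp
  let ?P = "cycle_law \<Otimes>\<^sub>M (\<nu> \<Otimes>\<^sub>M lborel)"
  have "(\<lambda>x. fst (snd x)) \<in> ?P \<rightarrow>\<^sub>M \<nu>" "fst \<in> ?P \<rightarrow>\<^sub>M cycle_law" "(\<lambda>x. snd (snd x)) \<in> ?P \<rightarrow>\<^sub>M lborel"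
    by measurable
  then have [measurable]: "(\<lambda>x. fst (snd x)) \<in> borel_measurable ?P" "fst \<in> borel_measurable ?P"
      "(\<lambda>x. snd (snd x)) \<in> borel_measurable ?P"
    by (simp_all add: measurable_cong_sets[OF refl sets_law] measurable_cong_sets[OF refl sets_cycle_law])
  have "(\<integral>\<^sup>+x. f x \<partial>palm_measure) = (\<integral>\<^sup>+x. f (gap_state (fst x) (fst (snd x)) (snd (snd x)))
        * indicator {0..<fst (fst (snd x))} (snd (snd x)) \<partial>(cycle_law \<Otimes>\<^sub>M (\<nu> \<Otimes>\<^sub>M lborel)))"
    unfolding palm_measure_def
    by (subst nn_integral_distr)
       (auto simp: nn_integral_density mult.commute gap_state_in_state_space
             intro!: measurable_restrict_space2)
  also have "\<dots> = (\<integral>\<^sup>+C. (\<integral>\<^sup>+e. (\<integral>\<^sup>+s. f (gap_state C e s) * indicator {0..<fst e} s \<partial>lborel) \<partial>\<nu>) \<partial>cycle_law)"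
    by (simp add: gap.nn_integral_fst[symmetric] lborel.nn_integral_fst[symmetric])
  finally show ?thesis .
qed

text \<open>
  Running the queue for a time \<open>t\<close> replaces the window \<open>[0, a)\<close> by \<open>[t, t + a)\<close>.  The difference
  consists of \<open>[a, a + t)\<close>, which carries the occupation time of the next state, and of \<open>[0, t)\<close>,
  which carries the occupation time of the present state.  Their means agree since \<open>cycle_law\<close> is
  invariant, and they are finite, so they cancel.
\<close>

lemma palm_measure_stationary:
  assumes A: "A \<in> sets borel" and t: "0 \<le> t"
  shows "(\<integral>\<^sup>+x. transition A t x \<partial>palm_measure) = (\<integral>\<^sup>+x. indicator A x \<partial>palm_measure)"
proof -
  note [measurable] = A
  let ?W = "\<lambda>C e I. \<integral>\<^sup>+s. flow A s C e * indicator I s \<partial>lborel"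
  let ?h = "occupation_time A t"
  have W_meas [measurable]: "(\<lambda>x. ?W (fst x) (snd x) {0..<t}) \<in> borel_measurable (borel \<Otimes>\<^sub>M \<nu>)"
    "(\<lambda>x. ?W (fst x) (snd x) {0..<fst (snd x)}) \<in> borel_measurable (borel \<Otimes>\<^sub>M \<nu>)"
    "(\<lambda>x. ?W (fst x) (snd x) {t..<fst (snd x) + t}) \<in> borel_measurable (borel \<Otimes>\<^sub>M \<nu>)"
    by measurable
  have split: "?W C e {t..<fst e + t} + ?W C e {0..<t} = ?W C e {0..<fst e} + ?h (next_arrival_state C e)"
    if e: "0 \<le> fst e" for C e
  proof -
    have "?W C e {t..<fst e + t} + ?W C e {0..<t} = ?W C e {0..<fst e + t}"
      using nn_integral_window_split[of "\<lambda>s. flow A s C e" 0 t "fst e + t"] t e by (simp add: add.commute)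
    also have "\<dots> = ?W C e {0..<fst e} + ?W C e {fst e..<fst e + t}"
      using nn_integral_window_split[of "\<lambda>s. flow A s C e" 0 "fst e" "fst e + t"] t e by simp
    finally show ?thesis using flow_window_after_gap[OF A e t] by simp
  qed
  have "(\<integral>\<^sup>+x. transition A t x \<partial>palm_measure) + (\<integral>\<^sup>+C. ?h C \<partial>cycle_law)
     = (\<integral>\<^sup>+C. (\<integral>\<^sup>+e. ?W C e {t..<fst e + t} \<partial>\<nu>) \<partial>cycle_law) + (\<integral>\<^sup>+C. (\<integral>\<^sup>+e. ?W C e {0..<t} \<partial>\<nu>) \<partial>cycle_law)"
    by (simp add: nn_integral_palm_measure transition_window[OF A t] occupation_time_renewal[OF A])
  also have "\<dots> = (\<integral>\<^sup>+C. (\<integral>\<^sup>+e. ?W C e {t..<fst e + t} + ?W C e {0..<t} \<partial>\<nu>) \<partial>cycle_law)"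
    by (simp add: nn_integral_add)
  also have "\<dots> = (\<integral>\<^sup>+C. (\<integral>\<^sup>+e. ?W C e {0..<fst e} + ?h (next_arrival_state C e) \<partial>\<nu>) \<partial>cycle_law)"
  proof (rule nn_integral_cong, rule nn_integral_cong_AE)
    fix C
    show "AE e in \<nu>. ?W C e {t..<fst e + t} + ?W C e {0..<t} = ?W C e {0..<fst e} + ?h (next_arrival_state C e)"
      using law_nonneg by eventually_elim (rule split, simp)
  qed
  also have "\<dots> = (\<integral>\<^sup>+C. (\<integral>\<^sup>+e. ?W C e {0..<fst e} \<partial>\<nu>) \<partial>cycle_law) + (\<integral>\<^sup>+C. (\<integral>\<^sup>+e. ?h (next_arrival_state C e) \<partial>\<nu>) \<partial>cycle_law)"
    by (simp add: nn_integral_add)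
  also have "\<dots> = (\<integral>\<^sup>+x. indicator A x \<partial>palm_measure) + (\<integral>\<^sup>+C. ?h C \<partial>cycle_law)"
    by (simp add: nn_integral_palm_measure flow_window_in_gap[OF A] cycle_law_invariant)
  finally have eq: "(\<integral>\<^sup>+x. transition A t x \<partial>palm_measure) + (\<integral>\<^sup>+C. ?h C \<partial>cycle_law)
     = (\<integral>\<^sup>+x. indicator A x \<partial>palm_measure) + (\<integral>\<^sup>+C. ?h C \<partial>cycle_law)" .
  have "(\<integral>\<^sup>+C. ?h C \<partial>cycle_law) \<le> (\<integral>\<^sup>+C. ennreal t \<partial>cycle_law)"
    by (intro nn_integral_mono occupation_time_le A t)
  also have "\<dots> < \<infinity>" using emeasure_cycle_law_finite by (simp add: ennreal_mult_less_top)
  finally show ?thesis using eq by (auto simp: ennreal_add_left_cancel add.commute)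
qed

theorem exists_invariant_law: "\<exists>\<pi>. invariant_law \<pi>"
proof -
  define c where "c = emeasure palm_measure state_space"
  have sets_palm: "sets palm_measure = sets (restrict_space borel state_space)"
    by (simp add: palm_measure_def)
  note [measurable_cong] = sets_palm
  have "c = (\<integral>\<^sup>+x. indicator state_space x \<partial>palm_measure)"
    unfolding c_def by (rule nn_integral_indicator[symmetric]) (simp add: sets_palm sets_state_space_iff)
  also have "\<dots> = (\<integral>\<^sup>+C. (\<integral>\<^sup>+e. (\<integral>\<^sup>+s. indicator {0..<fst e} s \<partial>lborel) \<partial>\<nu>) \<partial>cycle_law)"
    by (simp add: nn_integral_palm_measure gap_state_in_state_space)
  also have "\<dots> = (\<integral>\<^sup>+C. (\<integral>\<^sup>+e. ennreal (fst e) \<partial>\<nu>) \<partial>cycle_law)"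
  proof (rule nn_integral_cong, rule nn_integral_cong_AE)
    show "AE e in \<nu>. (\<integral>\<^sup>+s. indicator {0..<fst e} s \<partial>lborel) = ennreal (fst e)"
      using law_nonneg by eventually_elim simp
  qed
  finally have c: "c = ennreal mean_gap * emeasure cycle_law UNIV"
    by (simp add: nn_integral_gap)
  have c0: "c \<noteq> 0" using mean_pos emeasure_cycle_law_ge_1 unfolding c mean_gap_def by auto
  have cfin: "c \<noteq> top" using emeasure_cycle_law_finite unfolding c by (simp add: ennreal_mult_eq_top_iff)
  define \<pi> where "\<pi> = scale_measure (inverse c) palm_measure"
  have inv: "inverse c * c = 1"
    using ennreal_divide_self[of c] c0 cfin by (simp add: divide_ennreal_def mult.commute less_top)
  have sets: "sets \<pi> = sets (restrict_space borel state_space)" by (simp add: \<pi>_def sets_palm)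
  have "prob_space \<pi>"
    by (rule prob_spaceI)
       (use inv in \<open>simp add: space_of_state_law[OF sets], simp add: \<pi>_def c_def[symmetric]\<close>)
  moreover have "emeasure \<pi> A = (\<integral>\<^sup>+x. transition A t x \<partial>\<pi>)" if t: "0 \<le> t" and A: "A \<in> sets \<pi>" for t A
  proof -
    have A': "A \<in> sets borel" "A \<in> sets palm_measure" using A sets sets_palm sets_state_space_iff by auto
    have "transition A t \<in> borel_measurable borel" using A'(1) by measurable
    then have "transition A t \<in> borel_measurable palm_measure"
      unfolding measurable_cong_sets[OF sets_palm refl] by (rule measurable_restrict_space1)
    then have "(\<integral>\<^sup>+x. transition A t x \<partial>\<pi>) = inverse c * (\<integral>\<^sup>+x. transition A t x \<partial>palm_measure)"
      unfolding \<pi>_def by (rule nn_integral_scale_measure)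
    also have "\<dots> = emeasure \<pi> A"
      using A'(2) by (simp add: palm_measure_stationary[OF A'(1) t] \<pi>_def)
    finally show ?thesis ..
  qed
  ultimately show ?thesis using sets unfolding invariant_law_def by blast
qed

end

section \<open>Uniqueness of the stationary law\<close>

lemma nn_integral_window_mono:
  fixes f :: "real \<Rightarrow> ennreal"
  assumes "x' \<le> x" "y \<le> y'"
  shows "(\<integral>\<^sup>+s. f s * indicator {x..<y} s \<partial>lborel) \<le> (\<integral>\<^sup>+s. f s * indicator {x'..<y'} s \<partial>lborel)"
  by (intro nn_integral_mono) (use assms in \<open>auto simp: indicator_def\<close>)

context stable_customer_law
begin

text \<open>
  The occupation times seen from a state and from its successor differ by at most the first gap at
  either end of the window.
\<close>

lemma occupation_time_le_next:
  assumes A[measurable]: "A \<in> sets borel" and T: "0 \<le> T"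
  shows "occupation_time A T C
     \<le> ennreal mean_gap + (\<integral>\<^sup>+e. occupation_time A T (next_arrival_state C e) \<partial>\<nu>)"
proof -
  let ?W = "\<lambda>e I. \<integral>\<^sup>+s. flow A s C e * indicator I s \<partial>lborel"
  have "?W e {0..<T} \<le> ennreal (fst e) + occupation_time A T (next_arrival_state C e)"
    if e: "0 \<le> fst e" for e
  proof -
    have "?W e {0..<T} \<le> ?W e {0..<fst e + T}" by (rule nn_integral_window_mono) (use e in auto)
    also have "\<dots> = ?W e {0..<fst e} + ?W e {fst e..<fst e + T}"
      by (rule nn_integral_window_split) (use e T in auto)
    also have "?W e {fst e..<fst e + T} = occupation_time A T (next_arrival_state C e)"
      by (rule flow_window_after_gap[OF A e T])
    also have "?W e {0..<fst e} \<le> ennreal (fst e)"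
      using nn_integral_window_le[of "\<lambda>s. flow A s C e" 0 "fst e"] flow_le_1[OF A] e by simp
    finally show ?thesis by (simp add: add_right_mono)
  qed
  then have "occupation_time A T C \<le> (\<integral>\<^sup>+e. ennreal (fst e) + occupation_time A T (next_arrival_state C e) \<partial>\<nu>)"
    unfolding occupation_time_renewal[OF A] using law_nonneg
    by (intro nn_integral_mono_AE) (auto elim: eventually_mono)
  then show ?thesis by (simp add: nn_integral_add nn_integral_gap)
qed

lemma next_occupation_time_le:
  assumes A[measurable]: "A \<in> sets borel" and T: "0 \<le> T"
  shows "(\<integral>\<^sup>+e. occupation_time A T (next_arrival_state C e) \<partial>\<nu>)
     \<le> ennreal mean_gap + occupation_time A T C"
proof -
  let ?W = "\<lambda>e I. \<integral>\<^sup>+s. flow A s C e * indicator I s \<partial>lborel"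
  have "occupation_time A T (next_arrival_state C e) \<le> ennreal (fst e) + ?W e {0..<T}"
    if e: "0 \<le> fst e" for e
  proof -
    have "occupation_time A T (next_arrival_state C e) = ?W e {fst e..<fst e + T}"
      by (rule flow_window_after_gap[OF A e T, symmetric])
    also have "\<dots> \<le> ?W e {0..<fst e + T}" by (rule nn_integral_window_mono) (use e in auto)
    also have "\<dots> = ?W e {0..<T} + ?W e {T..<fst e + T}"
      by (rule nn_integral_window_split) (use e T in auto)
    also have "?W e {T..<fst e + T} \<le> ennreal (fst e)"
      using nn_integral_window_le[of "\<lambda>s. flow A s C e" T "fst e + T"] flow_le_1[OF A] e by simp
    finally show ?thesis by (simp add: add_left_mono add.commute)
  qed
  then have "(\<integral>\<^sup>+e. occupation_time A T (next_arrival_state C e) \<partial>\<nu>)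
      \<le> (\<integral>\<^sup>+e. ennreal (fst e) + ?W e {0..<T} \<partial>\<nu>)"
    using law_nonneg by (intro nn_integral_mono_AE) (auto elim: eventually_mono)
  also have "\<dots> = ennreal mean_gap + occupation_time A T C"
    unfolding occupation_time_renewal[OF A] by (subst nn_integral_add) (auto simp: nn_integral_gap)
  finally show ?thesis .
qed

lemma nn_integral_taboo_bound:
  assumes [measurable]: "q \<in> borel_measurable borel"
  shows "(\<integral>\<^sup>+e. a + c * (q (next_arrival_state C e) * indicator (- {(0, 0)}) (next_arrival_state C e)) \<partial>\<nu>)
     = a + c * taboo q C"
  unfolding taboo_def by (simp add: nn_integral_add nn_integral_cmult emeasure_space_1)

text \<open>
  Shift coupling in analytic form.  Each of \<open>n\<close> steps towards \<open>(0, 0)\<close> costs at most one mean gap,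
  and a path that has not reached \<open>(0, 0)\<close> by then costs at most the whole window.  Hence the
  occupation times of all initial states agree up to \<open>n\<close> mean gaps and a small multiple of \<open>T\<close>.
\<close>

lemma occupation_time_compare:
  assumes A[measurable]: "A \<in> sets borel" and T: "0 \<le> T"
  defines "\<epsilon> \<equiv> \<lambda>n C. of_nat n * ennreal mean_gap + ennreal T * (taboo ^^ n) (\<lambda>_. 1) C"
  shows "occupation_time A T C \<le> occupation_time A T (0, 0) + \<epsilon> n C"
    and "occupation_time A T (0, 0) \<le> occupation_time A T C + \<epsilon> n C"
proof (induction n arbitrary: C)
  case 0
  {
    case 1 show ?case
      using occupation_time_le[OF A T, of C] by (simp add: \<epsilon>_def add_increasing)
  next
    case 2 show ?case
      using occupation_time_le[OF A T, of "(0, 0)"] by (simp add: \<epsilon>_def add_increasing)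
  }
next
  case (Suc n)
  let ?h = "occupation_time A T" and ?m = "of_nat n * ennreal mean_gap" and ?q = "(taboo ^^ n) (\<lambda>_. 1)"
  let ?I = "\<lambda>C e. ?q (next_arrival_state C e) * indicator (- {(0, 0)}) (next_arrival_state C e)"
  {
    case 1
    have "?h (next_arrival_state C e) \<le> (?h (0, 0) + ?m) + ennreal T * ?I C e" for e
      using Suc(1)[of "next_arrival_state C e"]
      by (cases "next_arrival_state C e = (0, 0)") (auto simp: \<epsilon>_def ac_simps add_increasing2)
    then have "(\<integral>\<^sup>+e. ?h (next_arrival_state C e) \<partial>\<nu>) \<le> (\<integral>\<^sup>+e. (?h (0, 0) + ?m) + ennreal T * ?I C e \<partial>\<nu>)"
      by (intro nn_integral_mono) 
    also have "\<dots> = (?h (0, 0) + ?m) + ennreal T * taboo ?q C"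
      by (rule nn_integral_taboo_bound) simp
    finally have "?h C \<le> ennreal mean_gap + ((?h (0, 0) + ?m) + ennreal T * taboo ?q C)"
      using occupation_time_le_next[OF A T, of C] by (meson add_left_mono order_trans)
    then show ?case by (simp add: \<epsilon>_def algebra_simps)
  next
    case 2
    have *: "?h (0, 0) \<le> (?h (next_arrival_state C e) + ?m) + ennreal T * ?I C e" for e
      using Suc(2)[of "next_arrival_state C e"]
      by (cases "next_arrival_state C e = (0, 0)") (auto simp: \<epsilon>_def ac_simps add_increasing2)
    have "?h (0, 0) = (\<integral>\<^sup>+e. ?h (0, 0) \<partial>\<nu>)" by (simp add: emeasure_space_1)
    also have "\<dots> \<le> (\<integral>\<^sup>+e. ?h (next_arrival_state C e) + (?m + ennreal T * ?I C e) \<partial>\<nu>)"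
      by (intro nn_integral_mono) (use * in \<open>simp add: ac_simps\<close>)
    also have "\<dots> = (\<integral>\<^sup>+e. ?h (next_arrival_state C e) \<partial>\<nu>) + (\<integral>\<^sup>+e. ?m + ennreal T * ?I C e \<partial>\<nu>)"
      by (rule nn_integral_add) measurable
    also have "(\<integral>\<^sup>+e. ?m + ennreal T * ?I C e \<partial>\<nu>) = ?m + ennreal T * taboo ?q C"
      by (rule nn_integral_taboo_bound) simp
    also have "(\<integral>\<^sup>+e. ?h (next_arrival_state C e) \<partial>\<nu>) \<le> ennreal mean_gap + ?h C"
      by (rule next_occupation_time_le[OF A T])
    finally have "?h (0, 0) \<le> ennreal mean_gap + ?h C + (?m + ennreal T * taboo ?q C)"
      by (simp add: add_right_mono)
    then show ?case by (simp add: \<epsilon>_def algebra_simps)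
  }
qed

definition first_arrival_state :: "real \<times> real \<Rightarrow> real \<times> real" where
  "first_arrival_state x = (max 0 (snd x - fst x), max 0 (snd x - fst x))"

definition transition_time :: "(real \<times> real) set \<Rightarrow> real \<Rightarrow> real \<times> real \<Rightarrow> ennreal" where
  "transition_time A T x = (\<integral>\<^sup>+s. transition A s x * indicator {0..<T} s \<partial>lborel)"

lemma transition_time_le:
  assumes "A \<in> sets borel" "0 \<le> T" shows "transition_time A T x \<le> ennreal T"
  unfolding transition_time_def
  using nn_integral_window_le[of "\<lambda>s. transition A s x" 0 T] transition_le_1[OF assms(1)] assms(2) by simp

lemma transition_time_compare:
  assumes A[measurable]: "A \<in> sets borel" and T: "0 \<le> T" and x: "0 \<le> fst x"
  shows "transition_time A T x \<le> occupation_time A T (first_arrival_state x) + ennreal (fst x)"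
    and "occupation_time A T (first_arrival_state x) \<le> transition_time A T x + ennreal (fst x)"
proof -
  let ?W = "\<lambda>I. \<integral>\<^sup>+s. transition A s x * indicator I s \<partial>lborel"
  have h: "?W {fst x..<fst x + T} = occupation_time A T (first_arrival_state x)"
  proof -
    have "?W {fst x..<fst x + T} = (\<integral>\<^sup>+s. transition A (s + fst x) x * indicator {0..<T} s \<partial>lborel)"
      using nn_integral_window_shift[of "\<lambda>s. transition A s x" "fst x" 0 T] by (simp add: add.commute)
    then show ?thesis
      unfolding occupation_time_def
      by (simp, intro nn_integral_cong)
         (auto simp: indicator_def transition_def first_arrival_state_def Let_def)
  qed
  have le: "?W {a..<c} \<le> ennreal (c - a)" if "a \<le> c" for a c
    by (rule nn_integral_window_le[OF transition_le_1[OF A] that])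
  have "transition_time A T x \<le> ?W {0..<fst x + T}"
    unfolding transition_time_def by (rule nn_integral_window_mono) (use x in auto)
  also have "\<dots> = ?W {0..<fst x} + ?W {fst x..<fst x + T}"
    by (rule nn_integral_window_split) (use x T in auto)
  also have "\<dots> \<le> ennreal (fst x) + occupation_time A T (first_arrival_state x)"
    unfolding h using le[of 0 "fst x"] x by (intro add_right_mono) simp
  finally show "transition_time A T x \<le> occupation_time A T (first_arrival_state x) + ennreal (fst x)"
    by (simp only: add.commute)
  have "?W {fst x..<fst x + T} \<le> ?W {0..<fst x + T}" by (rule nn_integral_window_mono) (use x in auto)
  also have "\<dots> = transition_time A T x + ?W {T..<fst x + T}"
    unfolding transition_time_def by (rule nn_integral_window_split) (use x T in auto)
  also have "\<dots> \<le> transition_time A T x + ennreal (fst x)"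
    using le[of T "fst x + T"] x by (intro add_left_mono) simp
  finally show "occupation_time A T (first_arrival_state x) \<le> transition_time A T x + ennreal (fst x)"
    unfolding h .
qed

text \<open>
  A bound on the difference of time averages over a window of length \<open>n\<^sup>2\<close>, when \<open>n\<close> steps are
  allowed for reaching \<open>(0, 0)\<close>: the quadratic length makes the contributions of the first arrival
  time and of the \<open>n\<close> mean gaps negligible.
\<close>

definition discrepancy :: "nat \<Rightarrow> real \<times> real \<Rightarrow> ennreal" where
  "discrepancy n x = min 1 (ennreal (fst x / real n ^ 2) + ennreal (mean_gap / real n)
     + (taboo ^^ n) (\<lambda>_. 1) (first_arrival_state x))"

lemma discrepancy_measurable [measurable]: "discrepancy n \<in> borel_measurable borel"
proof -
  have "(\<lambda>x. (taboo ^^ n) (\<lambda>_. 1) (first_arrival_state x)) \<in> borel_measurable borel"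
    by (rule measurable_compose[OF _ taboo_pow_measurable]) (auto simp: first_arrival_state_def)
  then show ?thesis unfolding discrepancy_def by measurable
qed

lemma discrepancy_tendsto_0: "(\<lambda>n. discrepancy n x) \<longlonglongrightarrow> 0"
proof -
  have "(\<lambda>n. ennreal (fst x / real n ^ 2) + ennreal (mean_gap / real n)
     + (taboo ^^ n) (\<lambda>_. 1) (first_arrival_state x)) \<longlonglongrightarrow> ennreal 0 + ennreal 0 + 0"
  proof (intro tendsto_add tendsto_ennrealI)
    show "(\<lambda>n. fst x / real n ^ 2) \<longlonglongrightarrow> 0"
      by (rule real_tendsto_divide_at_top[OF tendsto_const])
         (auto intro!: filterlim_pow_at_top filterlim_real_sequentially)
    show "(\<lambda>n. mean_gap / real n) \<longlonglongrightarrow> 0"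
      by (rule real_tendsto_divide_at_top[OF tendsto_const filterlim_real_sequentially])
    show "(\<lambda>n. (taboo ^^ n) (\<lambda>_. 1) (first_arrival_state x)) \<longlonglongrightarrow> 0"
      by (rule ennreal_suminf_finite_imp_LIMSEQ_zero, rule taboo_sum_finite) (simp add: first_arrival_state_def)
  qed
  then have "(\<lambda>n. min 1 (ennreal (fst x / real n ^ 2) + ennreal (mean_gap / real n)
     + (taboo ^^ n) (\<lambda>_. 1) (first_arrival_state x))) \<longlonglongrightarrow> min 1 (ennreal 0 + ennreal 0 + 0)"
    by (intro tendsto_min tendsto_const)
  then show ?thesis by (simp add: discrepancy_def)
qed

lemma time_average_compare:
  assumes A: "A \<in> sets borel" and n: "n \<ge> 1" and x: "0 \<le> fst x"
  defines "T \<equiv> real n ^ 2"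
  shows "transition_time A T x \<le> occupation_time A T (0, 0) + ennreal T * discrepancy n x"
    and "occupation_time A T (0, 0) \<le> transition_time A T x + ennreal T * discrepancy n x"
proof -
  have T: "0 \<le> T" "0 < T" using n by (auto simp: T_def)
  let ?y = "ennreal (fst x / T) + ennreal (mean_gap / real n) + (taboo ^^ n) (\<lambda>_. 1) (first_arrival_state x)"
  have e1: "ennreal T * ennreal (fst x / T) = ennreal (fst x)"
    using T x by (simp flip: ennreal_mult)
  have e2: "ennreal T * ennreal (mean_gap / real n) = of_nat n * ennreal mean_gap"
  proof -
    have "0 < mean_gap" using mean_pos by (simp add: mean_gap_def)
    moreover have "T * (mean_gap / real n) = real n * mean_gap"
      using n by (simp add: T_def power2_eq_square)
    ultimately show ?thesis using T(1)
      by (simp add: ennreal_of_nat_eq_real_of_nat ennreal_mult[symmetric])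
  qed
  have y: "ennreal T * ?y = ennreal (fst x) + of_nat n * ennreal mean_gap
      + ennreal T * (taboo ^^ n) (\<lambda>_. 1) (first_arrival_state x)"
    by (simp add: distrib_left e1 e2)
  have d: "discrepancy n x = 1 \<or> discrepancy n x = ?y"
    by (auto simp: discrepancy_def min_def T_def)
  note c = occupation_time_compare[OF A T(1), of "first_arrival_state x" n]
    and t = transition_time_compare[OF A T(1) x]
  have "transition_time A T x \<le> occupation_time A T (0, 0) + ennreal T * ?y"
    using order_trans[OF t(1) add_right_mono[OF c(1)]] unfolding y by (simp only: ac_simps)
  moreover have "transition_time A T x \<le> occupation_time A T (0, 0) + ennreal T"
    using transition_time_le[OF A T(1)] by (simp add: add_increasing)
  ultimately show "transition_time A T x \<le> occupation_time A T (0, 0) + ennreal T * discrepancy n x"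
    using d by auto
  have "occupation_time A T (0, 0) \<le> transition_time A T x + ennreal T * ?y"
    using order_trans[OF c(2) add_right_mono[OF t(2)]] unfolding y by (simp only: ac_simps)
  moreover have "occupation_time A T (0, 0) \<le> transition_time A T x + ennreal T"
    using occupation_time_le[OF A T(1)] by (simp add: add_increasing)
  ultimately show "occupation_time A T (0, 0) \<le> transition_time A T x + ennreal T * discrepancy n x"
    using d by auto
qed

lemma state_law_measurable:
  assumes "sets \<pi> = sets (restrict_space borel state_space)" "f \<in> borel_measurable borel"
  shows "f \<in> borel_measurable \<pi>"
  unfolding measurable_cong_sets[OF assms(1) refl] by (rule measurable_restrict_space1[OF assms(2)])

lemma invariant_law_transition_time:
  assumes inv: "invariant_law \<pi>" and A: "A \<in> sets \<pi>" and T: "0 \<le> T"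
  shows "(\<integral>\<^sup>+x. transition_time A T x \<partial>\<pi>) = ennreal T * emeasure \<pi> A"
proof -
  have sets: "sets \<pi> = sets (restrict_space borel state_space)" using inv by (simp add: invariant_law_def)
  have [measurable]: "A \<in> sets borel" using A sets sets_state_space_iff by auto
  interpret \<pi>: prob_space \<pi> using inv by (simp add: invariant_law_def)
  interpret pair_sigma_finite \<pi> lborel
    by (simp add: pair_sigma_finite_def \<pi>.sigma_finite_measure_axioms lborel.sigma_finite_measure_axioms)
  have id: "(\<lambda>x. x) \<in> \<pi> \<rightarrow>\<^sub>M borel"
    unfolding measurable_cong_sets[OF sets refl] by (rule measurable_restrict_space1) simp
  have [measurable]: "fst \<in> borel_measurable (\<pi> \<Otimes>\<^sub>M lborel)" "fst \<in> borel_measurable (lborel \<Otimes>\<^sub>M \<pi>)"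
      "snd \<in> borel_measurable (\<pi> \<Otimes>\<^sub>M lborel)" 
    using measurable_compose[OF measurable_fst id] by auto
  have "(\<integral>\<^sup>+x. transition_time A T x \<partial>\<pi>)
      = (\<integral>\<^sup>+s. (\<integral>\<^sup>+x. transition A s x * indicator {0..<T} s \<partial>\<pi>) \<partial>lborel)"
    unfolding transition_time_def by (rule Fubini'[symmetric]) (simp add: split_beta')
  also have "\<dots> = (\<integral>\<^sup>+s. emeasure \<pi> A * indicator {0..<T} s \<partial>lborel)"
  proof (rule nn_integral_cong)
    fix s
    have "transition A s \<in> borel_measurable \<pi>" by (rule state_law_measurable[OF sets]) measurable
    then have "(\<integral>\<^sup>+x. transition A s x * indicator {0..<T} s \<partial>\<pi>) = (\<integral>\<^sup>+x. transition A s x \<partial>\<pi>) * indicator {0..<T} s"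
      by (rule nn_integral_multc)
    then show "(\<integral>\<^sup>+x. transition A s x * indicator {0..<T} s \<partial>\<pi>) = emeasure \<pi> A * indicator {0..<T} s"
      using inv A by (cases "s \<in> {0..<T}") (auto simp: invariant_law_def)
  qed
  also have "\<dots> = ennreal T * emeasure \<pi> A" using T by (simp add: nn_integral_cmult mult.commute)
  finally show ?thesis .
qed

lemma nn_integral_discrepancy_tendsto_0:
  assumes "invariant_law \<pi>"
  shows "(\<lambda>n. \<integral>\<^sup>+x. discrepancy n x \<partial>\<pi>) \<longlonglongrightarrow> 0"
proof -
  interpret \<pi>: prob_space \<pi> using assms by (simp add: invariant_law_def)
  have sets: "sets \<pi> = sets (restrict_space borel state_space)"
    using assms unfolding invariant_law_def by blast
  have "(\<lambda>n. \<integral>\<^sup>+x. discrepancy n x \<partial>\<pi>) \<longlonglongrightarrow> (\<integral>\<^sup>+x. 0 \<partial>\<pi>)"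
  proof (rule nn_integral_dominated_convergence[where w = "\<lambda>_. 1"])
    show "discrepancy n \<in> borel_measurable \<pi>" for n
      by (rule state_law_measurable[OF sets discrepancy_measurable])
    show "AE x in \<pi>. discrepancy n x \<le> 1" for n by (simp add: discrepancy_def)
    show "AE x in \<pi>. (\<lambda>n. discrepancy n x) \<longlonglongrightarrow> 0" by (simp add: discrepancy_tendsto_0)
    show "(\<integral>\<^sup>+x. 1 \<partial>\<pi>) < \<infinity>" by (simp add: \<pi>.emeasure_space_1)
  qed simp_all
  then show ?thesis by simp
qed

text \<open>
  By stationarity, \<open>\<pi> A\<close> is the \<open>\<pi>\<close>-mean of the time average over any window.  All these time
  averages are close to the one from \<open>(0, 0)\<close>, so by dominated convergence two stationary laws
  agree.  The truncation at 1 in \<open>discrepancy\<close> provides the integrable majorant.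
\<close>

lemma invariant_law_le:
  assumes inv: "invariant_law \<pi>1" "invariant_law \<pi>2" and A: "A \<in> sets \<pi>1"
  shows "emeasure \<pi>1 A \<le> emeasure \<pi>2 A"
proof -
  have sets: "sets \<pi>1 = sets (restrict_space borel state_space)" "sets \<pi>2 = sets (restrict_space borel state_space)"
    using inv by (auto simp: invariant_law_def)
  have A': "A \<in> sets borel" "A \<in> sets \<pi>2" using A sets sets_state_space_iff by auto
  interpret \<pi>1: prob_space \<pi>1 using inv by (simp add: invariant_law_def)
  interpret \<pi>2: prob_space \<pi>2 using inv by (simp add: invariant_law_def)
  have d1[measurable]: "discrepancy n \<in> borel_measurable \<pi>1" for n
    by (rule state_law_measurable[OF sets(1)]) measurable
  have d2[measurable]: "discrepancy n \<in> borel_measurable \<pi>2" for n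
    by (rule state_law_measurable[OF sets(2)]) measurable
  have tt: "transition_time A T \<in> borel_measurable borel" for T
    unfolding transition_time_def using A'(1) by measurable
  have tt2[measurable]: "transition_time A T \<in> borel_measurable \<pi>2" for T
    by (rule state_law_measurable[OF sets(2) tt])
  let ?D = "\<lambda>\<pi> n. \<integral>\<^sup>+x. discrepancy n x \<partial>\<pi>"
  have bound: "emeasure \<pi>1 A \<le> emeasure \<pi>2 A + ?D \<pi>2 n + ?D \<pi>1 n" if n: "n \<ge> 1" for n
  proof -
    let ?T = "real n ^ 2"
    let ?h = "occupation_time A ?T (0, 0)"
    have T: "0 < ?T" using n by simp
    have "ennreal ?T * emeasure \<pi>1 A = (\<integral>\<^sup>+x. transition_time A ?T x \<partial>\<pi>1)"
      using invariant_law_transition_time[OF inv(1) A, of ?T] by simp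
    also have "\<dots> \<le> (\<integral>\<^sup>+x. ?h + ennreal ?T * discrepancy n x \<partial>\<pi>1)"
      by (intro nn_integral_mono time_average_compare(1) A' n)
         (auto simp: space_of_state_law[OF sets(1)] state_space_def)
    also have "\<dots> = ?h + ennreal ?T * ?D \<pi>1 n"
      by (simp add: nn_integral_add nn_integral_cmult \<pi>1.emeasure_space_1)
    finally have 1: "ennreal ?T * emeasure \<pi>1 A \<le> ?h + ennreal ?T * ?D \<pi>1 n" .
    have "?h = (\<integral>\<^sup>+x. ?h \<partial>\<pi>2)" by (simp add: \<pi>2.emeasure_space_1)
    also have "\<dots> \<le> (\<integral>\<^sup>+x. transition_time A ?T x + ennreal ?T * discrepancy n x \<partial>\<pi>2)"
      by (intro nn_integral_mono time_average_compare(2) A' n)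
         (auto simp: space_of_state_law[OF sets(2)] state_space_def)
    also have "\<dots> = ennreal ?T * emeasure \<pi>2 A + ennreal ?T * ?D \<pi>2 n"
      using invariant_law_transition_time[OF inv(2) A'(2), of ?T]
      by (simp add: nn_integral_add nn_integral_cmult)
    finally have "ennreal ?T * emeasure \<pi>1 A \<le> ennreal ?T * (emeasure \<pi>2 A + ?D \<pi>2 n + ?D \<pi>1 n)"
      using 1 by (simp add: distrib_left) (meson add_right_mono order_trans)
    then show ?thesis using T by (subst (asm) ennreal_mult_le_mult_iff) auto
  qed
  have "(\<lambda>n. emeasure \<pi>2 A + ?D \<pi>2 n + ?D \<pi>1 n) \<longlonglongrightarrow> emeasure \<pi>2 A + 0 + 0"
    by (intro tendsto_add tendsto_const nn_integral_discrepancy_tendsto_0 inv)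
  then show ?thesis using bound by (intro LIMSEQ_le_const[where x = "emeasure \<pi>2 A"]) auto
qed

theorem ex1_invariant_law: "\<exists>!\<pi>. invariant_law \<pi>"
proof -
  have "\<pi>1 = \<pi>2" if inv: "invariant_law \<pi>1" "invariant_law \<pi>2" for \<pi>1 \<pi>2
  proof (rule measure_eqI)
    show "sets \<pi>1 = sets \<pi>2" using inv by (simp add: invariant_law_def)
    then show "emeasure \<pi>1 A = emeasure \<pi>2 A" if "A \<in> sets \<pi>1" for A
      using invariant_law_le inv that by (intro antisym) auto
  qed
  then show ?thesis using exists_invariant_law by blast
qed

end

section \<open>Queues with independent inputs\<close>

lemma driven_seq_cong: "(\<And>i. i < k \<Longrightarrow> e i = e' i) \<Longrightarrow> driven_seq G z e k = driven_seq G z e' k"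
  by (induction k) auto

lemma driven_seq_measurable:
  fixes G :: "'z::second_countable_topology \<Rightarrow> 'e::second_countable_topology \<Rightarrow> 'z"
  assumes G: "(\<lambda>x. G (fst x) (snd x)) \<in> borel \<Otimes>\<^sub>M borel \<rightarrow>\<^sub>M borel" and "k \<le> n"
  shows "(\<lambda>e. driven_seq G z e k) \<in> PiM {..<n} (\<lambda>_. borel) \<rightarrow>\<^sub>M borel"
  using assms(2)
proof (induction k)
  case (Suc k)
  then have "(\<lambda>e. (driven_seq G z e k, e k)) \<in> PiM {..<n} (\<lambda>_. borel) \<rightarrow>\<^sub>M borel \<Otimes>\<^sub>M borel"
    by (intro measurable_Pair measurable_component_singleton) auto
  from measurable_compose[OF this G] show ?case by simp
qed simp

text \<open>
  Independence is stated for variables with values in one type.  Their images under \<open>f\<close> and \<open>g\<close>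
  may have different types, so the conclusion is put as an identity of product measures.
\<close>

lemma (in prob_space) distr_pair_of_indep:
  assumes ind: "indep_var S X T Y" and f: "f \<in> S \<rightarrow>\<^sub>M S'" and g: "g \<in> T \<rightarrow>\<^sub>M T'"
  shows "distr M (S' \<Otimes>\<^sub>M T') (\<lambda>\<omega>. (f (X \<omega>), g (Y \<omega>)))
       = distr M S' (\<lambda>\<omega>. f (X \<omega>)) \<Otimes>\<^sub>M distr M T' (\<lambda>\<omega>. g (Y \<omega>))"
proof -
  have [measurable]: "X \<in> M \<rightarrow>\<^sub>M S" "Y \<in> M \<rightarrow>\<^sub>M T" and
    eq: "distr M S X \<Otimes>\<^sub>M distr M T Y = distr M (S \<Otimes>\<^sub>M T) (\<lambda>\<omega>. (X \<omega>, Y \<omega>))"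
    using ind unfolding indep_var_distribution_eq by auto
  note [measurable] = f g
  interpret D: prob_space "distr M T' (\<lambda>\<omega>. g (Y \<omega>))" by (rule prob_space_distr) measurable
  have fX: "distr M S' (\<lambda>\<omega>. f (X \<omega>)) = distr (distr M S X) S' f"
    and gY: "distr M T' (\<lambda>\<omega>. g (Y \<omega>)) = distr (distr M T Y) T' g"
    by (simp_all add: distr_distr comp_def)
  have "distr M S' (\<lambda>\<omega>. f (X \<omega>)) \<Otimes>\<^sub>M distr M T' (\<lambda>\<omega>. g (Y \<omega>))
     = distr (distr M S X \<Otimes>\<^sub>M distr M T Y) (S' \<Otimes>\<^sub>M T') (\<lambda>(x, y). (f x, g y))"
    unfolding fX gY
    by (rule pair_measure_distr) (use D.sigma_finite_measure_axioms in \<open>auto simp: gY[symmetric]\<close>)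
  also have "\<dots> = distr M (S' \<Otimes>\<^sub>M T') (\<lambda>\<omega>. (f (X \<omega>), g (Y \<omega>)))"
    unfolding eq by (subst distr_distr) (auto simp: comp_def)
  finally show ?thesis ..
qed

text \<open>
  Independent inputs turn powers of the transition operator into means over the probability space,
  since the state before the \<open>k\<close>-th input depends on the earlier inputs only.
\<close>

locale iid_inputs = prob_space M for M :: "'w measure" +
  fixes e :: "nat \<Rightarrow> 'w \<Rightarrow> 'e::second_countable_topology" and \<nu> :: "'e measure"
  assumes indep: "indep_vars (\<lambda>_. borel) e UNIV"
    and law: "\<And>k. distr M borel (e k) = \<nu>"
begin

lemma e_measurable [measurable]: "e k \<in> borel_measurable M"
  using indep by (auto simp: indep_vars_def2)

lemma driven_measurable:
  fixes G :: "'z::second_countable_topology \<Rightarrow> 'e \<Rightarrow> 'z"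
  assumes G: "(\<lambda>x. G (fst x) (snd x)) \<in> borel \<Otimes>\<^sub>M borel \<rightarrow>\<^sub>M borel"
  shows "(\<lambda>\<omega>. driven_seq G z (\<lambda>i. e i \<omega>) k) \<in> borel_measurable M"
proof (induction k)
  case (Suc k)
  then have "(\<lambda>\<omega>. (driven_seq G z (\<lambda>i. e i \<omega>) k, e k \<omega>)) \<in> M \<rightarrow>\<^sub>M borel \<Otimes>\<^sub>M borel" by measurable
  from measurable_compose[OF this G] show ?case by simp
qed simp

lemma distr_driven_input:
  fixes G :: "'z::second_countable_topology \<Rightarrow> 'e \<Rightarrow> 'z"
  assumes G: "(\<lambda>x. G (fst x) (snd x)) \<in> borel \<Otimes>\<^sub>M borel \<rightarrow>\<^sub>M borel"
  shows "distr M (borel \<Otimes>\<^sub>M borel) (\<lambda>\<omega>. (driven_seq G z (\<lambda>i. e i \<omega>) k, e k \<omega>))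
       = distr M borel (\<lambda>\<omega>. driven_seq G z (\<lambda>i. e i \<omega>) k) \<Otimes>\<^sub>M \<nu>"
proof -
  have ind: "indep_var (PiM {..<k} (\<lambda>_. borel)) (\<lambda>\<omega>. restrict (\<lambda>i. e i \<omega>) {..<k})
      (PiM {k} (\<lambda>_. borel)) (\<lambda>\<omega>. restrict (\<lambda>i. e i \<omega>) {k})"
    by (rule indep_var_restrict[OF indep]) auto
  have "driven_seq G z (restrict (\<lambda>i. e i \<omega>) {..<k}) k = driven_seq G z (\<lambda>i. e i \<omega>) k" for \<omega>
    by (rule driven_seq_cong) simp
  then show ?thesis
    using distr_pair_of_indep[OF ind driven_seq_measurable[OF G order_refl] measurable_component_singleton[of k], of z]
    by (simp add: law)
qed

lemma nn_integral_driven_input: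
  fixes G :: "'z::second_countable_topology \<Rightarrow> 'e \<Rightarrow> 'z"
  assumes G: "(\<lambda>x. G (fst x) (snd x)) \<in> borel \<Otimes>\<^sub>M borel \<rightarrow>\<^sub>M borel"
    and f: "(\<lambda>x. f (fst x) (snd x)) \<in> borel_measurable (borel \<Otimes>\<^sub>M borel)"
  shows "(\<integral>\<^sup>+\<omega>. f (driven_seq G z (\<lambda>i. e i \<omega>) k) (e k \<omega>) \<partial>M)
       = (\<integral>\<^sup>+\<omega>. (\<integral>\<^sup>+x. f (driven_seq G z (\<lambda>i. e i \<omega>) k) x \<partial>\<nu>) \<partial>M)"
proof -
  let ?Z = "\<lambda>\<omega>. driven_seq G z (\<lambda>i. e i \<omega>) k"
  note Z [measurable] = driven_measurable[OF G, of z k]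
  interpret \<nu>: prob_space \<nu> unfolding law[of 0, symmetric] by (rule prob_space_distr) measurable
  have sets_\<nu> [measurable_cong]: "sets \<nu> = sets borel" unfolding law[of 0, symmetric] by simp
  have f2: "(\<lambda>x. f (fst x) (snd x)) \<in> borel_measurable (borel \<Otimes>\<^sub>M \<nu>)"
    using f measurable_cong_sets[OF sets_pair_measure_cong[OF refl sets_\<nu>] refl] by blast
  have "(\<integral>\<^sup>+\<omega>. f (?Z \<omega>) (e k \<omega>) \<partial>M)
      = (\<integral>\<^sup>+x. f (fst x) (snd x) \<partial>distr M (borel \<Otimes>\<^sub>M borel) (\<lambda>\<omega>. (?Z \<omega>, e k \<omega>)))"
    by (subst nn_integral_distr) (use f in auto)
  also have "distr M (borel \<Otimes>\<^sub>M borel) (\<lambda>\<omega>. (?Z \<omega>, e k \<omega>)) = distr M borel ?Z \<Otimes>\<^sub>M \<nu>"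
    by (rule distr_driven_input[OF G])
  also have "(\<integral>\<^sup>+x. f (fst x) (snd x) \<partial>(distr M borel ?Z \<Otimes>\<^sub>M \<nu>))
     = (\<integral>\<^sup>+y. (\<integral>\<^sup>+x. f y x \<partial>\<nu>) \<partial>distr M borel ?Z)"
    using f2 by (subst \<nu>.nn_integral_fst[symmetric]) (auto cong: measurable_cong_sets)
  also have "\<dots> = (\<integral>\<^sup>+\<omega>. (\<integral>\<^sup>+x. f (?Z \<omega>) x \<partial>\<nu>) \<partial>M)"
    using \<nu>.borel_measurable_nn_integral_fst[OF f2] by (subst nn_integral_distr) auto
  finally show ?thesis .
qed

lemma nn_integral_driven:
  fixes G :: "'z::second_countable_topology \<Rightarrow> 'e \<Rightarrow> 'z"
  assumes G: "(\<lambda>x. G (fst x) (snd x)) \<in> borel \<Otimes>\<^sub>M borel \<rightarrow>\<^sub>M borel" and "\<phi> \<in> borel_measurable borel"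
  shows "(\<integral>\<^sup>+\<omega>. \<phi> (driven_seq G z (\<lambda>i. e i \<omega>) k) \<partial>M) = (next_mean \<nu> G ^^ k) \<phi> z"
  using assms(2)
proof (induction k arbitrary: \<phi>)
  case 0 then show ?case by (simp add: emeasure_space_1)
next
  case (Suc k)
  interpret \<nu>: prob_space \<nu> unfolding law[of 0, symmetric] by (rule prob_space_distr) measurable
  have sets_\<nu>: "sets \<nu> = sets borel" unfolding law[of 0, symmetric] by simp
  have f: "(\<lambda>x. \<phi> (G (fst x) (snd x))) \<in> borel_measurable (borel \<Otimes>\<^sub>M borel)"
    using measurable_compose[OF G Suc.prems] .
  then have f2: "(\<lambda>x. \<phi> (G (fst x) (snd x))) \<in> borel_measurable (borel \<Otimes>\<^sub>M \<nu>)"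
    using measurable_cong_sets[OF sets_pair_measure_cong[OF refl sets_\<nu>] refl] by blast
  have "next_mean \<nu> G \<phi> \<in> borel_measurable borel"
    using \<nu>.borel_measurable_nn_integral_fst[OF f2] by (simp add: next_mean_def[abs_def])
  from Suc.IH[OF this] show ?case
    using nn_integral_driven_input[OF G f, of z k] by (simp add: next_mean_def[symmetric] funpow_swap1)
qed

end

lemma fst_driven_clock: "fst (driven_seq clock_step (t, C) e k) = t - (\<Sum>i<k. fst (e i))"
  by (induction k) (auto simp: clock_step_def)

lemma snd_driven_clock: "snd (driven_seq clock_step (t, C) e k) = driven_seq next_arrival_state C e k"
  by (induction k) (auto simp: clock_step_def)

lemma arrival_time_eq_sum: "arrival_time \<tau>0 a (Suc k) = \<tau>0 + (\<Sum>i<k. a (i + 2))"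
  by (induction k) (auto simp: arrival_time_Suc, auto simp: arrival_time_def)

text \<open>
  Arrivals do not accumulate: for the sum \<open>S\<^sub>k\<close> of \<open>k\<close> interarrival times, the means of
  \<open>exp (- S\<^sub>k)\<close> form a convergent geometric series, so \<open>exp (- S\<^sub>k)\<close> tends to 0 almost surely.
\<close>

lemma (in stable_customer_law) inputs_diverge:
  assumes "iid_inputs M e \<nu>"
  shows "AE \<omega> in M. \<forall>r. \<exists>k. r < (\<Sum>i<k. fst (e i \<omega>))"
proof -
  interpret iid: iid_inputs M e \<nu> by fact
  define q where "q = (\<integral>x. exp (- fst x) \<partial>\<nu>)"
  have int: "integrable \<nu> (\<lambda>x. exp (- fst x))"
    by (rule integrable_const_bound[where B=1]) (use law_nonneg in eventually_elim, auto)
  have q0: "0 \<le> q" unfolding q_def by (rule integral_nonneg_AE) simp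
  have eq: "(\<integral>x. 1 - exp (- fst x) \<partial>\<nu>) = 1 - q"
    unfolding q_def using int prob_space by simp
  have nn: "AE x in \<nu>. 0 \<le> 1 - exp (- fst x)" using law_nonneg by eventually_elim simp
  have "q < 1"
  proof (rule ccontr)
    assume "\<not> q < 1"
    then have "(\<integral>x. 1 - exp (- fst x) \<partial>\<nu>) = 0"
      using eq integral_nonneg_AE[OF nn] by simp
    then have "AE x in \<nu>. 1 - exp (- fst x) = 0"
      using integral_nonneg_eq_0_iff_AE[OF _ nn] int by simp
    then have "AE x in \<nu>. fst x = 0" by eventually_elim simp
    then have "(\<integral>x. fst x \<partial>\<nu>) = 0" by (rule integral_eq_zero_AE)
    then show False using mean_pos by simp
  qed
  define G :: "real \<Rightarrow> real \<times> real \<times> real \<Rightarrow> real" where "G z x = z + fst x" for z x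
  define \<phi> :: "real \<Rightarrow> ennreal" where "\<phi> z = ennreal (exp (- z))" for z
  have G: "(\<lambda>x. G (fst x) (snd x)) \<in> borel \<Otimes>\<^sub>M borel \<rightarrow>\<^sub>M borel" unfolding G_def by measurable
  have sum: "driven_seq G 0 x k = (\<Sum>i<k. fst (x i))" for x k
    by (induction k) (auto simp: G_def)
  have "next_mean \<nu> G (\<lambda>z. ennreal q ^ k * \<phi> z) z = ennreal q ^ Suc k * \<phi> z" for k z
  proof -
    have "next_mean \<nu> G (\<lambda>z. ennreal q ^ k * \<phi> z) z = (\<integral>\<^sup>+x. (ennreal q ^ k * \<phi> z) * ennreal (exp (- fst x)) \<partial>\<nu>)"
      unfolding next_mean_def \<phi>_def G_def mult.assoc
      by (simp add: ennreal_mult[symmetric] exp_add[symmetric])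
    also have "\<dots> = (ennreal q ^ k * \<phi> z) * (\<integral>\<^sup>+x. ennreal (exp (- fst x)) \<partial>\<nu>)"
      by (rule nn_integral_cmult) measurable
    also have "(\<integral>\<^sup>+x. ennreal (exp (- fst x)) \<partial>\<nu>) = ennreal q"
      unfolding q_def by (rule nn_integral_eq_integral[OF int]) simp
    finally show ?thesis by (simp add: mult_ac)
  qed
  then have pow: "(next_mean \<nu> G ^^ k) \<phi> = (\<lambda>z. ennreal q ^ k * \<phi> z)" for k
    by (induction k) auto
  have [measurable]: "\<phi> \<in> borel_measurable borel" unfolding \<phi>_def by measurable
  have \<phi>0: "\<phi> 0 = 1" by (simp add: \<phi>_def)
  note [measurable] = iid.driven_measurable[OF G]
  have "(\<integral>\<^sup>+\<omega>. (\<Sum>k. \<phi> (driven_seq G 0 (\<lambda>i. e i \<omega>) k)) \<partial>M) = (\<Sum>k. ennreal q ^ k)"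
    using \<phi>0 by (subst nn_integral_suminf) (auto simp: iid.nn_integral_driven[OF G] pow)
  also have "\<dots> = (\<Sum>k. ennreal (q ^ k))" using q0 by (simp add: ennreal_power)
  also have "\<dots> \<noteq> top" using \<open>q < 1\<close> q0 by (intro ennreal_suminf_neq_top summable_geometric) auto
  finally have "AE \<omega> in M. (\<Sum>k. \<phi> (driven_seq G 0 (\<lambda>i. e i \<omega>) k)) \<noteq> \<infinity>"
    by (intro nn_integral_noteq_infinite) auto
  then show ?thesis
  proof eventually_elim
    case (elim \<omega>)
    then have lim: "(\<lambda>k. \<phi> (driven_seq G 0 (\<lambda>i. e i \<omega>) k)) \<longlonglongrightarrow> 0"
      by (intro ennreal_suminf_finite_imp_LIMSEQ_zero) (simp add: less_top)
    show ?case
    proof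
      fix r :: real
      have "eventually (\<lambda>k. \<phi> (driven_seq G 0 (\<lambda>i. e i \<omega>) k) < ennreal (exp (- r))) sequentially"
        using order_tendstoD(2)[OF lim] by simp
      then obtain k where "\<phi> (driven_seq G 0 (\<lambda>i. e i \<omega>) k) < ennreal (exp (- r))"
        by (auto simp: eventually_sequentially)
      then have "r < (\<Sum>i<k. fst (e i \<omega>))" by (simp add: \<phi>_def sum ennreal_less_iff)
      then show "\<exists>k. r < (\<Sum>i<k. fst (e i \<omega>))" ..
    qed
  qed
qed

text \<open>
  Decomposition of the state at time \<open>t\<close> according to the last arrival up to \<open>t\<close>; the gaps are
  disjoint, so only the term of that arrival can be nonzero.
\<close>

lemma queue_state_indicator:
  fixes a s d :: "nat \<Rightarrow> real"
  assumes path: "offered_waiting_path \<tau>0 v0 a s d V"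
    and nonneg: "0 \<le> \<tau>0" "0 \<le> v0" "\<And>j. j \<ge> 2 \<Longrightarrow> a j \<ge> 0" "\<And>j. j \<ge> 1 \<Longrightarrow> s j \<ge> 0"
    and div: "\<And>r. \<exists>k. r < (\<Sum>i<k. a (i + 2))" and t: "0 \<le> t"
  defines "e \<equiv> \<lambda>k. (a (k + 2), s (k + 1), d (k + 1))"
  defines "c \<equiv> max 0 (v0 - \<tau>0)"
  shows "t < \<tau>0 \<Longrightarrow> (remaining_arrival_time \<tau>0 a t, V t) = (\<tau>0 - t, max 0 (v0 - t))"
    and "\<tau>0 \<le> t \<Longrightarrow> indicator A (remaining_arrival_time \<tau>0 a t, V t) =
      (\<Sum>k. in_gap A (fst (driven_seq clock_step (t - \<tau>0, c, c) e k))
               (snd (driven_seq clock_step (t - \<tau>0, c, c) e k)) (e k))"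
proof -
  let ?t = "arrival_time \<tau>0 a"
  have t1: "?t (Suc 0) = \<tau>0" by (simp add: arrival_time_def)
  show "(remaining_arrival_time \<tau>0 a t, V t) = (\<tau>0 - t, max 0 (v0 - t))" if "t < \<tau>0"
  proof -
    have "num_arrivals \<tau>0 a t = 0" by (rule num_arrivals_eqI) (use nonneg that t1 in auto)
    then show ?thesis
      using offered_waiting_path_eq(1)[OF path nonneg t that] t1
      by (simp add: remaining_arrival_time_def)
  qed
  assume \<tau>0: "\<tau>0 \<le> t"
  define K where "K = (LEAST k. t < ?t (Suc (Suc k)))"
  obtain k0 where "t - \<tau>0 < (\<Sum>i<k0. a (i + 2))" using div by blast
  then have k0: "t < ?t (Suc k0)" by (simp add: arrival_time_eq_sum)
  also have "\<dots> \<le> ?t (Suc (Suc k0))" by (rule arrival_time_mono) (use nonneg in auto)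
  finally have "t < ?t (Suc (Suc k0))" .
  then have K2: "t < ?t (Suc (Suc K))" unfolding K_def by (rule LeastI)
  have K1: "?t (Suc K) \<le> t"
  proof (cases K)
    case 0 then show ?thesis using \<tau>0 t1 by simp
  next
    case (Suc j)
    then show ?thesis using not_less_Least[of j "\<lambda>k. t < ?t (Suc (Suc k))"] by (auto simp: K_def)
  qed
  have N: "num_arrivals \<tau>0 a t = Suc K" by (rule num_arrivals_eqI) (use nonneg K1 K2 in auto)
  let ?Z = "driven_seq clock_step (t - \<tau>0, c, c) e"
  have fZ: "fst (?Z k) = t - ?t (Suc k)" for k
    by (simp add: fst_driven_clock arrival_time_eq_sum e_def)
  have gap: "fst (e k) = ?t (Suc (Suc k)) - ?t (Suc k)" for k
    using arrival_time_Suc[of "Suc k" \<tau>0 a] by (simp add: e_def)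
  have other: "in_gap A (fst (?Z k)) (snd (?Z k)) (e k) = 0" if "k \<noteq> K" for k
  proof (cases "k < K")
    case True
    then have "?t (Suc (Suc k)) \<le> ?t (Suc K)" by (intro arrival_time_mono) (use nonneg in auto)
    then show ?thesis using K1 by (simp add: in_gap_def fZ gap)
  next
    case False
    then have "?t (Suc (Suc K)) \<le> ?t (Suc k)" using that by (intro arrival_time_mono) (use nonneg in auto)
    then show ?thesis using K2 by (simp add: in_gap_def fZ gap)
  qed
  have "(\<Sum>k. in_gap A (fst (?Z k)) (snd (?Z k)) (e k)) = in_gap A (fst (?Z K)) (snd (?Z K)) (e K)"
    using suminf_finite[of "{K}" "\<lambda>k. in_gap A (fst (?Z k)) (snd (?Z k)) (e k)"] other by simp
  also have "\<dots> = indicator A (?t (Suc (Suc K)) - t, max 0 (work_after (snd (?Z K)) (e K) - (t - ?t (Suc K))))"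
    unfolding in_gap_def fZ gap using K1 K2 by simp
  also have "max 0 (work_after (snd (?Z K)) (e K) - (t - ?t (Suc K))) = V t"
    using offered_waiting_path_eq(2)[OF path nonneg K1 K2] unfolding e_def c_def snd_driven_clock by simp
  also have "?t (Suc (Suc K)) - t = remaining_arrival_time \<tau>0 a t"
    by (simp add: remaining_arrival_time_def N)
  finally show "indicator A (remaining_arrival_time \<tau>0 a t, V t) =
      (\<Sum>k. in_gap A (fst (?Z k)) (snd (?Z k)) (e k))" ..
qed

text \<open>
  Every process that solves the offered waiting time equation has the transition function computed
  from the chain, because its paths are determined by the inputs.
\<close>

lemma (in stable_customer_law) queue_transition:
  fixes M :: "'w measure" and u v d :: "nat \<Rightarrow> 'w \<Rightarrow> real" and lam mu :: real
  assumes process: "offered_waiting_process M u v d lam mu x Y"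
    and iid: "iid_inputs M (\<lambda>k \<omega>. (u (k + 2) \<omega> / lam, v (k + 1) \<omega> / mu, d (k + 1) \<omega>)) \<nu>"
    and u: "\<And>j. j \<ge> 2 \<Longrightarrow> u j \<in> borel_measurable M"
    and pos: "0 < lam" "0 < mu" "\<And>j \<omega>. j \<ge> 2 \<Longrightarrow> \<omega> \<in> space M \<Longrightarrow> 0 \<le> u j \<omega>"
      "\<And>j \<omega>. j \<ge> 1 \<Longrightarrow> \<omega> \<in> space M \<Longrightarrow> 0 \<le> v j \<omega>"
    and x: "x \<in> state_space" and A [measurable]: "A \<in> sets borel" and t: "0 \<le> t"
  shows "emeasure M {\<omega> \<in> space M. (remaining_arrival_time (fst x) (\<lambda>j. u j \<omega> / lam) t, Y t \<omega>) \<in> A}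
       = transition A t x"
proof -
  define e where "e k \<omega> = (u (k + 2) \<omega> / lam, v (k + 1) \<omega> / mu, d (k + 1) \<omega>)" for k \<omega>
  interpret iid: iid_inputs M e \<nu> using iid unfolding e_def[abs_def] .
  define c where "c = max 0 (snd x - fst x)"
  let ?X = "\<lambda>\<omega>. (remaining_arrival_time (fst x) (\<lambda>j. u j \<omega> / lam) t, Y t \<omega>)"
  let ?Z = "\<lambda>\<omega>. driven_seq clock_step (t - fst x, c, c) (\<lambda>k. e k \<omega>)"
  have G: "(\<lambda>x. clock_step (fst x) (snd x)) \<in> borel \<Otimes>\<^sub>M borel \<rightarrow>\<^sub>M borel" by measurable
  note Z [measurable] = iid.driven_measurable[OF G]
  have [measurable]: "Y t \<in> borel_measurable M" using process t by (simp add: offered_waiting_process_def)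
  have at [measurable]: "(\<lambda>\<omega>. arrival_time (fst x) (\<lambda>j. u j \<omega> / lam) i) \<in> borel_measurable M" for i
    unfolding arrival_time_def using u by (intro borel_measurable_add borel_measurable_sum borel_measurable_divide) auto
  have [measurable]: "(\<lambda>\<omega>. num_arrivals (fst x) (\<lambda>j. u j \<omega> / lam) t) \<in> M \<rightarrow>\<^sub>M count_space UNIV"
    unfolding num_arrivals_def by measurable
  have "(\<lambda>\<omega>. arrival_time (fst x) (\<lambda>j. u j \<omega> / lam) (num_arrivals (fst x) (\<lambda>j. u j \<omega> / lam) t + 1)) \<in> borel_measurable M"
    by (rule measurable_compose_countable[where g = "\<lambda>\<omega>. num_arrivals (fst x) (\<lambda>j. u j \<omega> / lam) t"]) measurable
  then have [measurable]: "?X \<in> borel_measurable M"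
    unfolding remaining_arrival_time_def by measurable
  have path: "AE \<omega> in M. \<omega> \<in> space M \<and> (\<forall>r. \<exists>k. r < (\<Sum>i<k. fst (e i \<omega>))) \<and>
      offered_waiting_path (fst x) (snd x) (\<lambda>j. u j \<omega> / lam) (\<lambda>j. v j \<omega> / mu) (\<lambda>j. d j \<omega>) (\<lambda>t. Y t \<omega>)"
    using process inputs_diverge[OF iid.iid_inputs_axioms] AE_space unfolding offered_waiting_process_def by auto
  have x0: "0 \<le> fst x" "0 \<le> snd x" using x by (auto simp: state_space_def)
  have "emeasure M {\<omega> \<in> space M. ?X \<omega> \<in> A} = (\<integral>\<^sup>+\<omega>. indicator {\<omega> \<in> space M. ?X \<omega> \<in> A} \<omega> \<partial>M)"
    by (rule nn_integral_indicator[symmetric]) measurable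
  also have "\<dots> = (\<integral>\<^sup>+\<omega>. indicator A (?X \<omega>) \<partial>M)"
    by (intro nn_integral_cong) (simp add: indicator_def)
  also have "\<dots> = transition A t x"
  proof (cases "t < fst x")
    case True
    have "(\<integral>\<^sup>+\<omega>. indicator A (?X \<omega>) \<partial>M) = (\<integral>\<^sup>+\<omega>. indicator A (fst x - t, max 0 (snd x - t)) \<partial>M)"
    proof (rule nn_integral_cong_AE)
      show "AE \<omega> in M. (indicator A (?X \<omega>) :: ennreal) = indicator A (fst x - t, max 0 (snd x - t))"
        using path
      proof eventually_elim
        case (elim \<omega>)
        have "?X \<omega> = (fst x - t, max 0 (snd x - t))"
          by (rule queue_state_indicator(1)[where s = "\<lambda>j. v j \<omega> / mu" and d = "\<lambda>j. d j \<omega>" and V = "\<lambda>t. Y t \<omega>"])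
             (use elim x0 pos t True in \<open>auto simp: e_def\<close>)
        then show ?case by simp
      qed
    qed
    then show ?thesis using True by (simp add: transition_def iid.emeasure_space_1)
  next
    case False
    have "(\<integral>\<^sup>+\<omega>. indicator A (?X \<omega>) \<partial>M)
        = (\<integral>\<^sup>+\<omega>. (\<Sum>k. in_gap A (fst (?Z \<omega> k)) (snd (?Z \<omega> k)) (e k \<omega>)) \<partial>M)"
    proof (rule nn_integral_cong_AE)
      show "AE \<omega> in M. indicator A (?X \<omega>) = (\<Sum>k. in_gap A (fst (?Z \<omega> k)) (snd (?Z \<omega> k)) (e k \<omega>))"
        using path
      proof eventually_elim
        case (elim \<omega>)
        show ?case unfolding e_def c_def
          by (rule queue_state_indicator(2)[where s = "\<lambda>j. v j \<omega> / mu" and d = "\<lambda>j. d j \<omega>" and V = "\<lambda>t. Y t \<omega>"])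
             (use elim x0 pos t False in \<open>auto simp: e_def\<close>)
      qed
    qed
    also have "\<dots> = (\<Sum>k. \<integral>\<^sup>+\<omega>. in_gap A (fst (?Z \<omega> k)) (snd (?Z \<omega> k)) (e k \<omega>) \<partial>M)"
      by (rule nn_integral_suminf) measurable
    also have "\<dots> = (\<Sum>k. \<integral>\<^sup>+\<omega>. gap_mean A (?Z \<omega> k) \<partial>M)"
      unfolding gap_mean_def
      by (subst iid.nn_integral_driven_input[OF G, where f = "\<lambda>z x. in_gap A (fst z) (snd z) x"]) auto
    also have "\<dots> = occupation A (t - fst x) (c, c)"
      unfolding occupation_def by (simp add: iid.nn_integral_driven[OF G])
    finally show ?thesis using False by (simp add: transition_def c_def Let_def)
  qed
  finally show ?thesis .
qed

section \<open>Independence of the customers\<close>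

context abandonment_queues
begin

lemma UNIV_primitive: "(UNIV :: primitive set) = {Interarrival, Service, Patience}"
  using primitive.exhaust by auto

lemma primitives_measurable:
  assumes "n \<ge> 1" "i \<in> primitive_index k"
  shows "primitive_seq u v (d n) k i \<in> borel_measurable M"
  using assms u_indep v_indep d_indep[OF assms(1)] by (cases k) (auto simp: indep_vars_def2)

lemma primitives_indep_each:
  assumes "n \<ge> 1"
  shows "indep_vars (\<lambda>_. borel) (primitive_seq u v (d n) k) (primitive_index k)"
  using u_indep v_indep d_indep[OF assms] by (cases k) auto

text \<open>
  Independence within and between the three sequences gives independence of the whole family: the
  probability of a finite cylinder event factors first over the sequences and then over the entries.
\<close>

lemma primitives_indep:
  assumes n: "n \<ge> 1"
  shows "indep_vars (\<lambda>_. borel) (\<lambda>(k, i). primitive_seq u v (d n) k i) (Sigma UNIV primitive_index)"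
proof -
  let ?Y = "\<lambda>(k, i). primitive_seq u v (d n) k i"
  have "indep_sets (\<lambda>p. {?Y p -` A \<inter> space M | A. A \<in> sets borel}) (Sigma UNIV primitive_index)"
  proof (rule indep_setsI)
    fix p assume "p \<in> Sigma UNIV primitive_index"
    then show "{?Y p -` A \<inter> space M | A. A \<in> sets borel} \<subseteq> events"
      using primitives_measurable[OF n] by (auto intro: measurable_sets)
  next
    fix A J assume J: "J \<noteq> {}" "J \<subseteq> Sigma UNIV primitive_index" "finite J"
      and A: "\<forall>p\<in>J. A p \<in> {?Y p -` A \<inter> space M | A. A \<in> sets borel}"
    then have "\<forall>p\<in>J. \<exists>B. B \<in> sets borel \<and> A p = ?Y p -` B \<inter> space M" by auto
    then obtain B where B: "\<And>p. p \<in> J \<Longrightarrow> B p \<in> sets borel" "\<And>p. p \<in> J \<Longrightarrow> A p = ?Y p -` B p \<inter> space M"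
      by metis
    define Jk where "Jk k = {i. (k, i) \<in> J}" for k
    have J_eq: "J = Sigma UNIV Jk" by (auto simp: Jk_def)
    have Jk: "finite (Jk k)" "Jk k \<subseteq> primitive_index k" for k
      using J finite_subset[of "Jk k" "snd ` J"] by (force simp: Jk_def)+
    define X where "X k \<omega> = (\<lambda>i\<in>primitive_index k. primitive_seq u v (d n) k i \<omega>)" for k \<omega>
    define Cyl where "Cyl k = {x \<in> space (PiM (primitive_index k) (\<lambda>_. borel)). \<forall>i\<in>Jk k. x i \<in> B (k, i)}" for k
    have Cyl: "Cyl k \<in> sets (PiM (primitive_index k) (\<lambda>_. borel :: real measure))" for k
      unfolding Cyl_def
    proof (rule sets.sets_Collect_finite_All[OF _ Jk(1)])
      fix i assume i: "i \<in> Jk k"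
      have "(\<lambda>x. x i) \<in> PiM (primitive_index k) (\<lambda>_. borel) \<rightarrow>\<^sub>M (borel :: real measure)"
        by (rule measurable_component_singleton) (use i Jk in auto)
      from measurable_sets[OF this B(1)[of "(k, i)"]] i
      show "{x \<in> space (PiM (primitive_index k) (\<lambda>_. borel)). x i \<in> B (k, i)}
          \<in> sets (PiM (primitive_index k) (\<lambda>_. borel :: real measure))"
        by (simp add: Jk_def vimage_def Int_def conj_commute)
    qed
    have XCyl: "X k -` Cyl k \<inter> space M = {\<omega> \<in> space M. \<forall>i\<in>Jk k. ?Y (k, i) \<omega> \<in> B (k, i)}" for k
      using Jk(2)[of k] by (auto simp: X_def Cyl_def space_PiM PiE_def)
    have each: "prob (X k -` Cyl k \<inter> space M) = (\<Prod>i\<in>Jk k. prob (A (k, i)))" for k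
    proof (cases "Jk k = {}")
      case True then show ?thesis unfolding XCyl by (simp add: prob_space)
    next
      case False
      have "X k -` Cyl k \<inter> space M = (\<Inter>i\<in>Jk k. primitive_seq u v (d n) k i -` B (k, i) \<inter> space M)"
        unfolding XCyl using False by auto
      also have "prob \<dots> = (\<Prod>i\<in>Jk k. prob (primitive_seq u v (d n) k i -` B (k, i) \<inter> space M))"
        by (rule indep_varsD[OF primitives_indep_each[OF n] False Jk]) (use B in \<open>auto simp: Jk_def\<close>)
      also have "\<dots> = (\<Prod>i\<in>Jk k. prob (A (k, i)))"
        by (rule prod.cong) (use B in \<open>auto simp: Jk_def\<close>)
      finally show ?thesis .
    qed
    have "(\<Inter>p\<in>J. A p) = (\<Inter>k\<in>UNIV. X k -` Cyl k \<inter> space M)"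
      unfolding XCyl using B(2) J(1) by (fastforce simp: Jk_def)
    then have "prob (\<Inter>p\<in>J. A p) = prob (\<Inter>k\<in>UNIV. X k -` Cyl k \<inter> space M)" by simp
    also have "\<dots> = (\<Prod>k\<in>UNIV. prob (X k -` Cyl k \<inter> space M))"
      by (rule indep_varsD[OF sequences_indep[OF n, folded X_def]])
         (use Cyl in \<open>auto simp: UNIV_primitive\<close>)
    also have "\<dots> = (\<Prod>k\<in>UNIV. \<Prod>i\<in>Jk k. prob (A (k, i)))" by (simp add: each)
    also have "\<dots> = (\<Prod>p\<in>J. prob (A p))"
      unfolding J_eq by (subst prod.Sigma) (use Jk in \<open>auto simp: UNIV_primitive\<close>)
    finally show "prob (\<Inter>p\<in>J. A p) = (\<Prod>p\<in>J. prob (A p))" .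
  qed
  then show ?thesis
    unfolding indep_vars_def2 using primitives_measurable[OF n] by auto
qed

text \<open>
  Customer \<open>k + 1\<close> is bundled with the interarrival time that follows it.
\<close>

definition customer :: "nat \<Rightarrow> nat \<Rightarrow> 'w \<Rightarrow> real \<times> real \<times> real" where
  "customer n k \<omega> = (u (k + 2) \<omega> / \<Lambda> n, v (k + 1) \<omega> / \<mu> n, d n (k + 1) \<omega>)"

lemma customers_indep:
  assumes n: "n \<ge> 1"
  shows "indep_vars (\<lambda>_. borel) (customer n) UNIV"
proof -
  let ?Y = "\<lambda>(k, i). primitive_seq u v (d n) k i"
  define K where "K k = {(Interarrival, k + 2), (Service, k + 1), (Patience, k + 1)}" for k :: nat
  define f where "f k x = (x (Interarrival, k + 2) / \<Lambda> n, x (Service, k + 1) / \<mu> n, x (Patience, k + 1))"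
    for k :: nat and x :: "primitive \<times> nat \<Rightarrow> real"
  have "indep_vars (\<lambda>k. PiM (K k) (\<lambda>_. borel)) (\<lambda>k \<omega>. restrict (\<lambda>p. ?Y p \<omega>) (K k)) UNIV"
    by (rule indep_vars_restrict[OF primitives_indep[OF n]]) (auto simp: K_def disjoint_family_on_def)
  then have "indep_vars (\<lambda>_. borel) (\<lambda>k \<omega>. f k (restrict (\<lambda>p. ?Y p \<omega>) (K k))) UNIV"
  proof (rule indep_vars_compose2)
    fix k :: nat
    have [measurable]: "(\<lambda>x. x p) \<in> borel_measurable (PiM (K k) (\<lambda>_. borel :: real measure))" if "p \<in> K k" for p
      using that by (rule measurable_component_singleton)
    have "(\<lambda>x. x (Interarrival, k + 2)) \<in> borel_measurable (PiM (K k) (\<lambda>_. borel :: real measure))"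
      "(\<lambda>x. x (Service, k + 1)) \<in> borel_measurable (PiM (K k) (\<lambda>_. borel :: real measure))"
      "(\<lambda>x. x (Patience, k + 1)) \<in> borel_measurable (PiM (K k) (\<lambda>_. borel :: real measure))"
      by (auto intro!: measurable_component_singleton simp: K_def)
    then show "f k \<in> PiM (K k) (\<lambda>_. borel) \<rightarrow>\<^sub>M borel"
      unfolding f_def by (intro borel_measurable_Pair borel_measurable_divide borel_measurable_const)
  qed
  moreover have "f k (restrict (\<lambda>p. ?Y p \<omega>) (K k)) = customer n k \<omega>" for k \<omega>
    by (simp add: f_def K_def customer_def)
  ultimately show ?thesis by (simp add: customer_def[abs_def])
qed

lemma distr_primitives_triple:
  assumes n: "n \<ge> 1" and i: "i \<ge> 2" and j: "j \<ge> 1"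
  shows "distr M (borel \<Otimes>\<^sub>M (borel \<Otimes>\<^sub>M borel)) (\<lambda>\<omega>. (u i \<omega>, v j \<omega>, d n j \<omega>))
     = distr M borel (u i) \<Otimes>\<^sub>M (distr M borel (v j) \<Otimes>\<^sub>M distr M borel (d n j))"
proof -
  let ?Y = "\<lambda>(k, i). primitive_seq u v (d n) k i"
  let ?u = "(Interarrival, i)" and ?v = "(Service, j)" and ?d = "(Patience, j)"
  let ?P = "\<lambda>S. PiM S (\<lambda>_. borel :: real measure)"
  have comp: "(\<lambda>x. x p) \<in> borel_measurable (?P S)" if "p \<in> S" for p :: "primitive \<times> nat" and S
    using that by (rule measurable_component_singleton)
  have pair: "(\<lambda>x. (x ?v, x ?d)) \<in> ?P {?v, ?d} \<rightarrow>\<^sub>M borel \<Otimes>\<^sub>M borel"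
    by (intro measurable_Pair comp) auto
  have 1: "indep_var (?P {?u}) (\<lambda>\<omega>. restrict (\<lambda>p. ?Y p \<omega>) {?u}) (?P {?v, ?d}) (\<lambda>\<omega>. restrict (\<lambda>p. ?Y p \<omega>) {?v, ?d})"
    by (rule indep_var_restrict[OF primitives_indep[OF n]]) (use i j in auto)
  have 2: "indep_var (?P {?v}) (\<lambda>\<omega>. restrict (\<lambda>p. ?Y p \<omega>) {?v}) (?P {?d}) (\<lambda>\<omega>. restrict (\<lambda>p. ?Y p \<omega>) {?d})"
    by (rule indep_var_restrict[OF primitives_indep[OF n]]) (use i j in auto)
  show ?thesis
    using distr_pair_of_indep[OF 1 comp[of ?u] pair] distr_pair_of_indep[OF 2 comp[of ?v] comp[of ?d]]
    by simp
qed

definition customer_distribution :: "nat \<Rightarrow> (real \<times> real \<times> real) measure" where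
  "customer_distribution n = distr M borel (customer n 0)"

lemma patience_identical:
  assumes "n \<ge> 1" "i \<ge> 1" shows "distr M borel (d n i) = distr M borel (d n 1)"
proof (rule cdf_unique)
  have [measurable]: "d n i \<in> borel_measurable M" "d n 1 \<in> borel_measurable M"
    using primitives_measurable[OF assms(1), of _ Patience] assms by auto
  show "real_distribution (distr M borel (d n i))" "real_distribution (distr M borel (d n 1))"
    by (simp_all add: real_distribution_distr del: One_nat_def)
  show "cdf (distr M borel (d n i)) = cdf (distr M borel (d n 1))"
    using d_cdf[OF assms] d_cdf[OF assms(1), of 1] by simp
qed

lemma customers_identical:
  assumes n: "n \<ge> 1" shows "distr M borel (customer n k) = customer_distribution n"
proof -
  let ?B = "borel \<Otimes>\<^sub>M (borel \<Otimes>\<^sub>M borel) :: (real \<times> real \<times> real) measure"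
  let ?f = "\<lambda>(x, y, z). (x / \<Lambda> n, y / \<mu> n, z)"
  have 1: "distr M borel (customer n k) = distr (distr M ?B (\<lambda>\<omega>. (u (k + 2) \<omega>, v (k + 1) \<omega>, d n (k + 1) \<omega>))) borel ?f" for k
  proof -
    have [measurable]: "u (k + 2) \<in> borel_measurable M" "v (k + 1) \<in> borel_measurable M" "d n (k + 1) \<in> borel_measurable M"
      using primitives_measurable[OF n, of _ Interarrival] primitives_measurable[OF n, of _ Service]
        primitives_measurable[OF n, of _ Patience] by auto
    have f: "?f \<in> ?B \<rightarrow>\<^sub>M borel" by measurable
    have "(\<lambda>\<omega>. (u (k + 2) \<omega>, v (k + 1) \<omega>, d n (k + 1) \<omega>)) \<in> M \<rightarrow>\<^sub>M ?B" by measurable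
    from distr_distr[OF f this] show ?thesis by (simp add: comp_def customer_def[abs_def])
  qed
  have "distr M borel (customer n k)
      = distr (distr M borel (u 2) \<Otimes>\<^sub>M (distr M borel (v 1) \<Otimes>\<^sub>M distr M borel (d n 1))) borel ?f" for k
    unfolding 1 using distr_primitives_triple[OF n, of "k + 2" "k + 1"]
      u_identical[of "k + 2"] v_identical[of "k + 1"] patience_identical[OF n, of "k + 1"]
    by (simp only: le_add2)
  then show ?thesis unfolding customer_distribution_def by metis
qed

lemma customers_iid: "n \<ge> 1 \<Longrightarrow> iid_inputs M (customer n) (customer_distribution n)"
  by (simp add: iid_inputs_def iid_inputs_axioms_def prob_space_axioms customers_indep customers_identical)

end

section \<open>Stability in the limit and the theorem\<close>

declare One_nat_def [simp del]

context abandonment_queues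
begin

lemma primitives_pair_indep:
  assumes n: "n \<ge> 1" and i: "i \<in> primitive_index k" and j: "j \<in> primitive_index l" and ne: "k \<noteq> l"
  shows "indep_var borel (primitive_seq u v (d n) k i) borel (primitive_seq u v (d n) l j)"
proof -
  let ?Y = "\<lambda>(k, i). primitive_seq u v (d n) k i"
  have "indep_var (PiM {(k, i)} (\<lambda>_. borel)) (\<lambda>\<omega>. restrict (\<lambda>p. ?Y p \<omega>) {(k, i)})
      (PiM {(l, j)} (\<lambda>_. borel)) (\<lambda>\<omega>. restrict (\<lambda>p. ?Y p \<omega>) {(l, j)})"
    by (rule indep_var_restrict[OF primitives_indep[OF n]]) (use i j ne in auto)
  then have "indep_var borel ((\<lambda>x. x (k, i)) \<circ> (\<lambda>\<omega>. restrict (\<lambda>p. ?Y p \<omega>) {(k, i)}))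
      borel ((\<lambda>x. x (l, j)) \<circ> (\<lambda>\<omega>. restrict (\<lambda>p. ?Y p \<omega>) {(l, j)}))"
    by (rule indep_var_compose) (auto intro: measurable_component_singleton)
  then show ?thesis by (simp add: comp_def)
qed

lemma patience_tail:
  assumes n: "n \<ge> 1" shows "prob {\<omega> \<in> space M. b < d n 1 \<omega>} = 1 - F n b"
proof -
  have [measurable]: "d n 1 \<in> borel_measurable M"
    using primitives_measurable[OF n, of 1 Patience] by simp
  have "F n b = prob (d n 1 -` {..b} \<inter> space M)"
    using fun_cong[OF d_cdf[OF n, of 1], of b] by (simp add: cdf_def measure_distr)
  moreover have "prob (space M - (d n 1 -` {..b} \<inter> space M)) = 1 - prob (d n 1 -` {..b} \<inter> space M)"
    by (rule prob_compl) measurable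
  moreover have "space M - (d n 1 -` {..b} \<inter> space M) = {\<omega> \<in> space M. b < d n 1 \<omega>}" by auto
  ultimately show ?thesis by simp
qed

lemma service_small_positive: "0 < prob {\<omega> \<in> space M. v 1 \<omega> \<le> 2}"
proof (rule ccontr)
  have [measurable]: "v 1 \<in> borel_measurable M" using primitives_measurable[of 1 1 Service] by simp
  assume "\<not> 0 < prob {\<omega> \<in> space M. v 1 \<omega> \<le> 2}"
  then have "prob {\<omega> \<in> space M. v 1 \<omega> \<le> 2} = 0"
    using measure_nonneg[of M "{\<omega> \<in> space M. v 1 \<omega> \<le> 2}"] by linarith
  then have "AE \<omega> in M. \<not> v 1 \<omega> \<le> 2" by (subst (asm) prob_eq_0) auto
  then have "AE \<omega> in M. 2 \<le> v 1 \<omega>" by eventually_elim simp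
  moreover have "integrable M (v 1)"
    using v_mean[of 1] not_integrable_integral_eq[of M "v 1"] by fastforce
  ultimately have "expectation (\<lambda>_. 2) \<le> expectation (v 1)" by (intro integral_mono_AE) auto
  then show False using v_mean[of 1] prob_space by simp
qed

text \<open>
  A long interarrival time and a short service time are independent events of positive probability,
  which gives \<open>clearing\<close>; independence of service and patience turns \<open>drift\<close> into the inequality
  between the arrival rate of persistent customers and the service rate.
\<close>

lemma stable_customer_distribution:
  assumes n: "n \<ge> 1" and b: "0 \<le> b" and stable: "\<Lambda> n * (1 - F n b) < \<mu> n"
    and unbounded: "\<And>r. r > 0 \<Longrightarrow> prob {\<omega> \<in> space M. u 2 \<omega> \<ge> r} > 0"
  shows "stable_customer_law (customer_distribution n) b"
proof -
  interpret iid: iid_inputs M "customer n" "customer_distribution n" by (rule customers_iid[OF n])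
  let ?\<nu> = "customer_distribution n"
  note pos = rates_pos[OF n]
  have meas [measurable]: "u 2 \<in> borel_measurable M" "v 1 \<in> borel_measurable M" "d n 1 \<in> borel_measurable M"
    using primitives_measurable[OF n, of 2 Interarrival] primitives_measurable[OF n, of 1 Service]
      primitives_measurable[OF n, of 1 Patience] by auto
  have c0: "customer n 0 = (\<lambda>\<omega>. (u 2 \<omega> / \<Lambda> n, v 1 \<omega> / \<mu> n, d n 1 \<omega>))"
    by (simp add: customer_def[abs_def] numeral_2_eq_2)
  have c0_meas [measurable]: "customer n 0 \<in> M \<rightarrow>\<^sub>M borel" by (rule iid.e_measurable)
  have int_u: "integrable M (u 2)" and int_v: "integrable M (v 1)"
    using u_mean[of 2] v_mean[of 1] not_integrable_integral_eq[of M "u 2"]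
      not_integrable_integral_eq[of M "v 1"] by fastforce+
  have ind_vd: "indep_var borel (v 1) borel (d n 1)"
    using primitives_pair_indep[OF n, of 1 Service 1 Patience] by simp
  have ind_uv: "indep_var borel (u 2) borel (v 1)"
    using primitives_pair_indep[OF n, of 2 Interarrival 1 Service] by simp
  have fst_meas: "(fst :: real \<times> real \<times> real \<Rightarrow> real) \<in> borel_measurable borel"
    and s_meas: "(\<lambda>e :: real \<times> real \<times> real. fst (snd e)) \<in> borel_measurable borel" by measurable
  have q_meas: "(\<lambda>e :: real \<times> real \<times> real. fst (snd e) * of_bool (b < snd (snd e))) \<in> borel_measurable borel"
    by measurable
  have Ea: "(\<integral>e. fst e \<partial>?\<nu>) = 1 / \<Lambda> n"
    unfolding customer_distribution_def integral_distr[OF c0_meas fst_meas]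
    using u_mean[of 2] by (simp add: c0)
  have q: "(\<integral>e. fst (snd e) * of_bool (b < snd (snd e)) \<partial>?\<nu>) = (1 - F n b) / \<mu> n"
  proof -
    have "(\<integral>e. fst (snd e) * of_bool (b < snd (snd e)) \<partial>?\<nu>)
        = (\<integral>\<omega>. (v 1 \<omega> / \<mu> n) * of_bool (b < d n 1 \<omega>) \<partial>M)"
      unfolding customer_distribution_def integral_distr[OF c0_meas q_meas] by (simp add: c0)
    also have "\<dots> = (\<integral>\<omega>. v 1 \<omega> / \<mu> n \<partial>M) * (\<integral>\<omega>. of_bool (b < d n 1 \<omega>) \<partial>M)"
    proof (rule indep_var_lebesgue_integral)
      show "indep_var borel (\<lambda>\<omega>. v 1 \<omega> / \<mu> n) borel (\<lambda>\<omega>. of_bool (b < d n 1 \<omega>) :: real)"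
        using indep_var_compose[OF ind_vd, of "\<lambda>x. x / \<mu> n" borel "\<lambda>x. of_bool (b < x)" borel]
        by (simp add: comp_def)
      show "integrable M (\<lambda>\<omega>. v 1 \<omega> / \<mu> n)" using int_v by simp
      show "integrable M (\<lambda>\<omega>. of_bool (b < d n 1 \<omega>) :: real)"
        by (rule integrable_const_bound[where B = 1]) (auto simp: of_bool_def)
    qed
    also have "(\<integral>\<omega>. of_bool (b < d n 1 \<omega>) \<partial>M) = 1 - F n b"
    proof -
      have "(\<lambda>\<omega>. of_bool (b < d n 1 \<omega>) :: real) = indicator {\<omega>. b < d n 1 \<omega>}" by (auto simp: indicator_def)
      moreover have "{\<omega>. b < d n 1 \<omega>} \<inter> space M = {\<omega> \<in> space M. b < d n 1 \<omega>}" by auto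
      ultimately show ?thesis using patience_tail[OF n, of b] by simp
    qed
    also have "(\<integral>\<omega>. v 1 \<omega> / \<mu> n \<partial>M) = 1 / \<mu> n" using v_mean[of 1] by simp
    finally show ?thesis by simp
  qed
  interpret \<nu>: prob_space ?\<nu> by (simp add: customer_distribution_def prob_space_distr)
  show ?thesis
  proof (unfold_locales)
    show "sets ?\<nu> = sets borel" by (simp add: customer_distribution_def)
    show "AE e in ?\<nu>. 0 \<le> fst e \<and> 0 \<le> fst (snd e)"
      unfolding customer_distribution_def
      by (subst AE_distr_iff) (use u_nonneg v_nonneg pos in \<open>auto simp: c0\<close>)
    show "integrable ?\<nu> fst"
      unfolding customer_distribution_def integrable_distr_eq[OF c0_meas fst_meas] using int_u by (simp add: c0)
    show "integrable ?\<nu> (\<lambda>e. fst (snd e))"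
      unfolding customer_distribution_def integrable_distr_eq[OF c0_meas s_meas] using int_v by (simp add: c0)
    show "(\<integral>e. fst (snd e) * of_bool (b < snd (snd e)) \<partial>?\<nu>) < (\<integral>e. fst e \<partial>?\<nu>)"
      unfolding q Ea using stable pos by (simp add: field_simps)
    show "0 \<le> b" by (rule b)
    fix B :: real assume B: "0 \<le> B"
    define r where "r = \<Lambda> n * (B + 2 / \<mu> n + 1)"
    have r: "0 < r" using B pos by (simp add: r_def add_nonneg_pos)
    let ?E = "(\<lambda>\<omega>. (u 2 \<omega>, v 1 \<omega>)) -` ({r..} \<times> {..2}) \<inter> space M"
    have "prob ?E = prob (u 2 -` {r..} \<inter> space M) * prob (v 1 -` {..2} \<inter> space M)"
      by (rule indep_varD[OF ind_uv]) auto
    also have "u 2 -` {r..} \<inter> space M = {\<omega> \<in> space M. r \<le> u 2 \<omega>}" by auto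
    also have "v 1 -` {..2} \<inter> space M = {\<omega> \<in> space M. v 1 \<omega> \<le> 2}" by auto
    finally have "0 < prob ?E" using unbounded[OF r] service_small_positive by simp
    also have "prob ?E \<le> prob {\<omega> \<in> space M. B + v 1 \<omega> / \<mu> n < u 2 \<omega> / \<Lambda> n}"
    proof (rule finite_measure_mono)
      show "?E \<subseteq> {\<omega> \<in> space M. B + v 1 \<omega> / \<mu> n < u 2 \<omega> / \<Lambda> n}"
      proof
        fix \<omega> assume "\<omega> \<in> ?E"
        then have *: "r \<le> u 2 \<omega>" "v 1 \<omega> \<le> 2" "\<omega> \<in> space M" by auto
        have "B + v 1 \<omega> / \<mu> n \<le> B + 2 / \<mu> n" using * pos by (simp add: divide_right_mono)
        also have "\<dots> < r / \<Lambda> n" using pos by (simp add: r_def)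
        also have "\<dots> \<le> u 2 \<omega> / \<Lambda> n" using * pos by (simp add: divide_right_mono)
        finally show "\<omega> \<in> {\<omega> \<in> space M. B + v 1 \<omega> / \<mu> n < u 2 \<omega> / \<Lambda> n}" using *(3) by simp
      qed
    qed measurable
    also have "\<dots> = measure ?\<nu> {e \<in> space ?\<nu>. B + fst (snd e) < fst e}"
    proof -
      have "measure ?\<nu> {e \<in> space ?\<nu>. B + fst (snd e) < fst e}
          = prob (customer n 0 -` {e. B + fst (snd e) < fst e} \<inter> space M)"
        unfolding customer_distribution_def by (simp add: measure_distr)
      also have "customer n 0 -` {e. B + fst (snd e) < fst e} \<inter> space M
          = {\<omega> \<in> space M. B + v 1 \<omega> / \<mu> n < u 2 \<omega> / \<Lambda> n}" by (auto simp: c0)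
      finally show ?thesis ..
    qed
    finally show "0 < measure ?\<nu> {e \<in> space ?\<nu>. B + fst (snd e) < fst e}" .
  qed
qed

text \<open>
  For a single system, stability only asks that for some level \<open>b\<close> the arrival rate of customers with
  patience beyond \<open>b\<close> is smaller than the service rate.
\<close>

lemma ex1_stationary_distribution:
  assumes n: "n \<ge> 1" and b: "0 \<le> b" and stable: "\<Lambda> n * (1 - F n b) < \<mu> n"
    and unbounded: "\<And>r. r > 0 \<Longrightarrow> prob {\<omega> \<in> space M. u 2 \<omega> \<ge> r} > 0"
    and V: "\<And>x. x \<in> state_space \<Longrightarrow> offered_waiting_process M u v (d n) (\<Lambda> n) (\<mu> n) x (Vn x)"
  shows "\<exists>!\<pi>. stationary_distribution M state_space (queue_state u (\<Lambda> n) Vn) \<pi>"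
proof -
  interpret S: stable_customer_law "customer_distribution n" b
    by (rule stable_customer_distribution[OF n b stable unbounded])
  have trans: "emeasure M {\<omega> \<in> space M. queue_state u (\<Lambda> n) Vn x t \<omega> \<in> A} = S.transition A t x"
    if "x \<in> state_space" "0 \<le> t" "A \<in> sets borel" for x t A
    unfolding queue_state_def
  proof (rule S.queue_transition[OF V[OF that(1)]])
    show "iid_inputs M (\<lambda>k \<omega>. (u (k + 2) \<omega> / \<Lambda> n, v (k + 1) \<omega> / \<mu> n, d n (k + 1) \<omega>)) (customer_distribution n)"
      using customers_iid[OF n] by (simp add: customer_def[abs_def])
    show "u j \<in> borel_measurable M" if "j \<ge> 2" for j
      using primitives_measurable[OF n, of j Interarrival] that by simp
  qed (use that rates_pos[OF n] u_nonneg v_nonneg in auto)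
  have "stationary_distribution M state_space (queue_state u (\<Lambda> n) Vn) \<pi> \<longleftrightarrow> S.invariant_law \<pi>" for \<pi>
  proof (cases "sets \<pi> = sets (restrict_space borel state_space)")
    case sets: True
    have "(\<integral>\<^sup>+x. emeasure M {\<omega> \<in> space M. queue_state u (\<Lambda> n) Vn x t \<omega> \<in> A} \<partial>\<pi>) = (\<integral>\<^sup>+x. S.transition A t x \<partial>\<pi>)"
      if "0 \<le> t" "A \<in> sets \<pi>" for t A
      by (rule nn_integral_cong) (use that sets_state_space_iff space_of_state_law[OF sets] sets trans in auto)
    then show ?thesis unfolding stationary_distribution_def S.invariant_law_def by (simp cong: conj_cong)
  qed (simp add: stationary_distribution_def S.invariant_law_def)
  then show ?thesis using S.ex1_invariant_law by simp
qed

end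

text \<open>
  The level is \<open>x / sqrt n\<close> for a fixed \<open>x\<close> with \<open>H x > \<theta> / lam\<close>: after multiplication by
  \<open>sqrt n\<close> the excess \<open>lam (1 - F n b) - \<mu> n / n\<close> tends to \<open>\<theta> - lam H x < 0\<close>.
\<close>

lemma eventually_stable:
  fixes F :: "nat \<Rightarrow> real \<Rightarrow> real" and H :: "real \<Rightarrow> real"
  assumes F: "\<And>n x. n \<ge> 1 \<Longrightarrow> 0 \<le> F n x \<and> F n x \<le> 1"
    and lam: "0 < lam"
    and mu: "(\<lambda>n. sqrt (real n) * (lam - \<mu> n / real n)) \<longlonglongrightarrow> \<theta>"
    and H: "continuous_on {0..} H"
    and unif: "\<And>K. K > 0 \<Longrightarrow>
      (\<lambda>n. SUP x\<in>{0..K}. \<bar>sqrt (real n) * F n (x / sqrt (real n)) - H x\<bar>) \<longlonglongrightarrow> 0"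
    and lim: "((\<lambda>x. ereal (H x)) \<longlongrightarrow> L) at_top" "ereal (\<theta> / lam) < L"
  shows "\<forall>\<^sub>F n in sequentially. \<exists>b\<ge>0. real n * lam * (1 - F n b) < \<mu> n"
proof -
  have "\<forall>\<^sub>F x in at_top. ereal (\<theta> / lam) < ereal (H x) \<and> 0 < x"
    using order_tendstoD(1)[OF lim] eventually_gt_at_top[of 0] by eventually_elim simp
  then obtain x where x: "\<theta> / lam < H x" "0 < x" by (auto simp: eventually_at_top_linorder)
  let ?D = "\<lambda>n y. \<bar>sqrt (real n) * F n (y / sqrt (real n)) - H y\<bar>"
  have "bounded (H ` {0..x})"
    by (intro compact_imp_bounded compact_continuous_image continuous_on_subset[OF H]) auto
  then obtain B where B: "\<And>y. y \<in> {0..x} \<Longrightarrow> \<bar>H y\<bar> \<le> B"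
    by (metis bounded_iff imageI real_norm_def)
  have le: "?D n x \<le> (SUP y\<in>{0..x}. ?D n y)" if n: "n \<ge> 1" for n
  proof (rule cSUP_upper)
    show "x \<in> {0..x}" using x by simp
    \<comment> \<open>A supremum of reals bounds its elements only if it is taken over a bounded set.\<close>
    show "bdd_above (?D n ` {0..x})"
    proof (rule bdd_aboveI2)
      fix y assume y: "y \<in> {0..x}"
      have "\<bar>sqrt (real n) * F n (y / sqrt (real n))\<bar> \<le> sqrt (real n)"
        using F[OF n, of "y / sqrt (real n)"] by (simp add: abs_mult mult_left_le)
      then show "?D n y \<le> sqrt (real n) + B" using B[OF y] by linarith
    qed
  qed
  have "(\<lambda>n. ?D n x) \<longlonglongrightarrow> 0"
  proof (rule tendsto_sandwich[OF _ _ tendsto_const unif[OF x(2)]])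
    show "\<forall>\<^sub>F n in sequentially. ?D n x \<le> (SUP y\<in>{0..x}. ?D n y)"
      using eventually_ge_at_top[of 1] by eventually_elim (rule le)
  qed simp
  then have "(\<lambda>n. sqrt (real n) * F n (x / sqrt (real n)) - H x) \<longlonglongrightarrow> 0"
    by (rule tendsto_rabs_zero_cancel)
  then have "(\<lambda>n. sqrt (real n) * F n (x / sqrt (real n))) \<longlonglongrightarrow> H x" by (simp add: LIM_zero_iff)
  then have "(\<lambda>n. sqrt (real n) * (lam - \<mu> n / real n) - lam * (sqrt (real n) * F n (x / sqrt (real n))))
      \<longlonglongrightarrow> \<theta> - lam * H x" by (intro tendsto_intros mu)
  moreover have "\<theta> - lam * H x < 0" using x(1) lam by (simp add: field_simps)
  ultimately have "\<forall>\<^sub>F n in sequentially.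
      sqrt (real n) * (lam - \<mu> n / real n) - lam * (sqrt (real n) * F n (x / sqrt (real n))) < 0"
    by (rule order_tendstoD(2))
  then show ?thesis using eventually_ge_at_top[of 1]
  proof eventually_elim
    case (elim n)
    then have "sqrt (real n) * (lam - \<mu> n / real n - lam * F n (x / sqrt (real n))) < 0"
      by (simp add: algebra_simps)
    then have "lam - \<mu> n / real n - lam * F n (x / sqrt (real n)) < 0"
      using elim(2) by (simp add: mult_less_0_iff)
    then have "real n * lam * (1 - F n (x / sqrt (real n))) < \<mu> n"
      using elim(2) by (simp add: field_simps)
    then show ?case using x(2) by (intro exI[of _ "x / sqrt (real n)"]) simp
  qed
qed

theorem theorem1:
  fixes M :: "'w measure"
    and u v :: "nat \<Rightarrow> 'w \<Rightarrow> real"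
    and d :: "nat \<Rightarrow> nat \<Rightarrow> 'w \<Rightarrow> real"
    and F :: "nat \<Rightarrow> real \<Rightarrow> real"
    and \<Lambda> \<mu> :: "nat \<Rightarrow> real"
    and V :: "nat \<Rightarrow> real \<times> real \<Rightarrow> real \<Rightarrow> 'w \<Rightarrow> real"
    and H :: "real \<Rightarrow> real"
    and p lam \<theta> :: real
  assumes model: "abandonment_queues M u v d F \<Lambda> \<mu>"
    and V: "\<And>n x. n \<ge> 1 \<Longrightarrow> x \<in> state_space \<Longrightarrow>
              offered_waiting_process M u v (d n) (\<Lambda> n) (\<mu> n) x (V n x)"
    and A1: "2 < p" "integrable M (\<lambda>\<omega>. u 2 \<omega> powr p + v 2 \<omega> powr p)"
    and A2: "0 < lam" "\<And>n. n \<ge> 1 \<Longrightarrow> \<Lambda> n = real n * lam"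
            "(\<lambda>n. \<mu> n / real n) \<longlonglongrightarrow> lam"
            "(\<lambda>n. sqrt (real n) * (lam - \<mu> n / real n)) \<longlonglongrightarrow> \<theta>"
    and A3: "\<And>n. n \<ge> 1 \<Longrightarrow> F n 0 = 0"
            "\<And>x. x \<ge> 0 \<Longrightarrow> H x \<ge> 0"
            "\<exists>H'. (\<forall>x\<ge>0. (H has_real_derivative H' x) (at x within {0..})) \<and>
                  continuous_on {0..} H'"
            "\<And>K. K > 0 \<Longrightarrow>
              (\<lambda>n. SUP x\<in>{0..K}. \<bar>sqrt (real n) * F n (x / sqrt (real n)) - H x\<bar>)
                \<longlonglongrightarrow> 0"
    and A4: "\<exists>L::ereal. ((\<lambda>x. ereal (H x)) \<longlongrightarrow> L) at_top \<and> ereal (\<theta> / lam) < L"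
    and A5: "\<And>r. r > 0 \<Longrightarrow> measure M {\<omega> \<in> space M. u 2 \<omega> \<ge> r} > 0"
  shows "\<forall>\<^sub>F n in sequentially.
           \<exists>!\<pi>. stationary_distribution M state_space (queue_state u (\<Lambda> n) (V n)) \<pi>"
proof -
  interpret abandonment_queues M u v d F \<Lambda> \<mu> by (rule model)
  obtain L where L: "((\<lambda>x. ereal (H x)) \<longlongrightarrow> L) at_top" "ereal (\<theta> / lam) < L" using A4 by blast
  obtain H' where "\<forall>x\<ge>0. (H has_real_derivative H' x) (at x within {0..})" using A3(3) by blast
  then have H: "continuous_on {0..} H"
    by (intro DERIV_continuous_on[where D = H']) auto
  have F: "0 \<le> F n x \<and> F n x \<le> 1" if "n \<ge> 1" for n x
  proof -
    have "F n x = 1 - prob {\<omega> \<in> space M. x < d n 1 \<omega>}" using patience_tail[OF that, of x] by simp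
    then show ?thesis by simp
  qed
  have "\<forall>\<^sub>F n in sequentially. \<exists>b\<ge>0. real n * lam * (1 - F n b) < \<mu> n"
    by (rule eventually_stable[OF F A2(1) A2(4) H A3(4) L])
  then show ?thesis using eventually_ge_at_top[of 1]
  proof eventually_elim
    case (elim n)
    then obtain b where "0 \<le> b" "\<Lambda> n * (1 - F n b) < \<mu> n" using A2(2) by auto
    then show ?case using elim(2) A5 V by (intro ex1_stationary_distribution) auto
  qed
qed

end
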